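(* Let $\mu>0$ and $H=L^2((0,\infty);\sqrt\omega\,d\omega)$. There exists a finite constant $C_\mu>0$ such that, for all $g,h,\ell\in H$, $$\|\Gamma_\mu(g,h)\|_H\le C_\mu\|g\|_H\|h\|_H\qquad\text{and}\qquad\|Q_\mu(g,h,\ell)\|_H\le C_\mu\|g\|_H\|h\|_H\|\ell\|_H.$$
   Context: Let $n(\omega)=\frac1{\omega+\mu}$. For $\omega_0=\omega>0$ let $D(\omega)=\{\omega_1,\omega_2>0,\ \omega_1+\omega_2>\omega\}$, $\omega_3=\omega_1+\omega_2-\omega$, $\Omega=\min(\sqrt{\omega_0},\sqrt{\omega_1},\sqrt{\omega_2},\sqrt{\omega_3})/\sqrt{\omega_0}$, and write $n_i=n(\omega_i)$, $g_i=g(\omega_i)$, $h_i=h(\omega_i)$, $\ell_i=\ell(\omega_i)$ for $i=0,1,2,3$. The bilinear and trilinear maps are, as functions of $\omega_0$, $$\Gamma_\mu(g,h)=\iint_{D(\omega_0)}\Omega\,n_1n_2n_3\Big[-g_0h_3(n_2^{-1}+n_1^{-1})+g_0h_1(n_3^{-1}-n_2^{-1})+g_0h_2(n_3^{-1}-n_1^{-1})+g_3h_1(n_1^{-1}-n_3^{-1})+g_3h_2(n_2^{-1}-n_3^{-1})+g_1h_2(n_2^{-1}+n_1^{-1})\Big]d\omega_1d\omega_2,$$ $$Q_\mu(g,h,\ell)=\iint_{D(\omega_0)}\Omega\,n_1n_2n_3\Big[n_3^{-1}g_0h_1\ell_2+n_0^{-1}g_1h_2\ell_3-n_1^{-1}g_0h_2\ell_3-n_2^{-1}g_0h_1\ell_3\Big]d\omega_1d\omega_2.$$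 They are defined by these formulas for smooth compactly supported functions on $(0,\infty)$; the estimates for such functions give the unique bounded multilinear extensions to $H$, for which the estimates are stated. *)

theory Defs
  imports "HOL-Analysis.Analysis"
begin

definition weight_measure :: "real measure" where
  "weight_measure = density (restrict_space lborel {0<..}) (\<lambda>\<omega>. ennreal (sqrt \<omega>))"

definition square_integrable :: "(real \<Rightarrow> real) set" where
  "square_integrable =
     {f \<in> borel_measurable weight_measure. integrable weight_measure (\<lambda>\<omega>. (f \<omega>)\<^sup>2)}"

definition H_rel :: "(real \<Rightarrow> real) \<Rightarrow> (real \<Rightarrow> real) \<Rightarrow> bool" where
  "H_rel f g \<longleftrightarrow> f \<in> square_integrable \<and> g \<in> square_integrable \<and>
     (AE \<omega> in weight_measure. f \<omega> = g \<omega>)"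

lemma square_integrable_measurable:
  "f \<in> square_integrable \<Longrightarrow> f \<in> borel_measurable weight_measure"
  by (simp add: square_integrable_def)

lemma square_integrable_zero: "(\<lambda>_. 0) \<in> square_integrable"
  by (simp add: square_integrable_def)

lemma square_integrable_mult:
  assumes "f \<in> square_integrable" "g \<in> square_integrable"
  shows "integrable weight_measure (\<lambda>\<omega>. f \<omega> * g \<omega>)"
proof (rule Bochner_Integration.integrable_bound)
  show "integrable weight_measure (\<lambda>\<omega>. (f \<omega>)\<^sup>2 + (g \<omega>)\<^sup>2)"
    using assms by (simp add: square_integrable_def)
  show "(\<lambda>\<omega>. f \<omega> * g \<omega>) \<in> borel_measurable weight_measure"
    using assms by (auto simp: square_integrable_def)
  have "\<bar>a * b\<bar> \<le> a\<^sup>2 + b\<^sup>2" for a b :: real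
  proof -
    have "2 * \<bar>a * b\<bar> \<le> a\<^sup>2 + b\<^sup>2"
      using sum_squares_bound[of "\<bar>a\<bar>" "\<bar>b\<bar>"] by (simp add: abs_mult mult.assoc)
    then show ?thesis
      using abs_ge_zero[of "a * b"] by linarith
  qed
  then show "AE \<omega> in weight_measure. norm (f \<omega> * g \<omega>) \<le> norm ((f \<omega>)\<^sup>2 + (g \<omega>)\<^sup>2)"
    by (intro AE_I2) simp
qed

lemma square_integrable_add:
  assumes "f \<in> square_integrable" "g \<in> square_integrable"
  shows "(\<lambda>\<omega>. f \<omega> + g \<omega>) \<in> square_integrable"
proof -
  have "integrable weight_measure (\<lambda>\<omega>. (f \<omega>)\<^sup>2 + (g \<omega>)\<^sup>2 + 2 * (f \<omega> * g \<omega>))"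
    using assms square_integrable_mult[OF assms] by (simp add: square_integrable_def)
  moreover have "(f \<omega> + g \<omega>)\<^sup>2 = (f \<omega>)\<^sup>2 + (g \<omega>)\<^sup>2 + 2 * (f \<omega> * g \<omega>)" for \<omega>
    by (simp add: power2_sum)
  ultimately show ?thesis
    using assms by (simp add: square_integrable_def borel_measurable_add)
qed

lemma square_integrable_scale:
  assumes "f \<in> square_integrable"
  shows "(\<lambda>\<omega>. c * f \<omega>) \<in> square_integrable"
  using assms by (simp add: square_integrable_def power_mult_distrib borel_measurable_times)

lemma square_integrable_uminus:
  assumes "f \<in> square_integrable"
  shows "(\<lambda>\<omega>. - f \<omega>) \<in> square_integrable"
  using square_integrable_scale[OF assms, of "-1"] by simp

lemma square_integrable_diff:
  assumes "f \<in> square_integrable" "g \<in> square_integrable"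
  shows "(\<lambda>\<omega>. f \<omega> - g \<omega>) \<in> square_integrable"
  using square_integrable_add[OF assms(1) square_integrable_uminus[OF assms(2)]] by simp

lemma part_equivp_H_rel: "part_equivp H_rel"
proof (rule part_equivpI)
  show "\<exists>f. H_rel f f"
    using square_integrable_zero by (auto simp: H_rel_def)
  show "symp H_rel"
    by (auto simp: symp_def H_rel_def)
  show "transp H_rel"
    by (auto simp: transp_def H_rel_def)
qed

quotient_type hspace = "real \<Rightarrow> real" / partial: H_rel
  by (rule part_equivp_H_rel)

definition to_H :: "(real \<Rightarrow> real) \<Rightarrow> hspace" where
  "to_H f = abs_hspace f"

instantiation hspace :: real_inner
begin

lift_definition zero_hspace :: hspace is "\<lambda>_. 0"
  by (simp add: H_rel_def square_integrable_zero)

lift_definition plus_hspace :: "hspace \<Rightarrow> hspace \<Rightarrow> hspace" is "\<lambda>f g \<omega>. f \<omega> + g \<omega>"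
  by (auto simp: H_rel_def intro: square_integrable_add)

lift_definition uminus_hspace :: "hspace \<Rightarrow> hspace" is "\<lambda>f \<omega>. - f \<omega>"
  by (auto simp: H_rel_def intro: square_integrable_uminus)

lift_definition minus_hspace :: "hspace \<Rightarrow> hspace \<Rightarrow> hspace" is "\<lambda>f g \<omega>. f \<omega> - g \<omega>"
  by (auto simp: H_rel_def intro: square_integrable_diff)

lift_definition scaleR_hspace :: "real \<Rightarrow> hspace \<Rightarrow> hspace" is "\<lambda>c f \<omega>. c * f \<omega>"
  by (auto simp: H_rel_def intro: square_integrable_scale)

lift_definition inner_hspace :: "hspace \<Rightarrow> hspace \<Rightarrow> real"
  is "\<lambda>f g. integral\<^sup>L weight_measure (\<lambda>\<omega>. f \<omega> * g \<omega>)"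
  by (rule integral_cong_AE)
     (auto simp: H_rel_def intro!: borel_measurable_times dest: square_integrable_measurable)

definition norm_hspace :: "hspace \<Rightarrow> real" where
  "norm_hspace f = sqrt (inner f f)"

definition dist_hspace :: "hspace \<Rightarrow> hspace \<Rightarrow> real" where
  "dist_hspace f g = norm (f - g)"

definition sgn_hspace :: "hspace \<Rightarrow> hspace" where
  "sgn_hspace f = inverse (norm f) *\<^sub>R f"

definition uniformity_hspace :: "(hspace \<times> hspace) filter" where
  "uniformity_hspace = (INF e\<in>{0<..}. principal {(f, g). dist f g < e})"

definition open_hspace :: "hspace set \<Rightarrow> bool" where
  "open_hspace U \<longleftrightarrow> (\<forall>f\<in>U. eventually (\<lambda>(f', g). f' = f \<longrightarrow> g \<in> U) uniformity)"

instance
proof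
  fix f g k :: hspace and a b :: real
  note sq = square_integrable_zero square_integrable_add square_integrable_scale
    square_integrable_uminus
  show "f + g + k = f + (g + k)"
    by transfer (simp add: H_rel_def sq add.assoc)
  show "f + g = g + f"
    by transfer (simp add: H_rel_def sq add.commute)
  show "0 + f = f"
    by transfer (simp add: H_rel_def)
  show "- f + f = 0"
    by transfer (simp add: H_rel_def sq)
  show "f - g = f + - g"
    by transfer (simp add: H_rel_def square_integrable_diff)
  show "a *\<^sub>R (f + g) = a *\<^sub>R f + a *\<^sub>R g"
    by transfer (simp add: H_rel_def sq distrib_left)
  show "(a + b) *\<^sub>R f = a *\<^sub>R f + b *\<^sub>R f"
    by transfer (simp add: H_rel_def sq distrib_right)
  show "a *\<^sub>R b *\<^sub>R f = (a * b) *\<^sub>R f"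
    by transfer (simp add: H_rel_def sq mult.assoc)
  show "1 *\<^sub>R f = f"
    by transfer simp
  show "dist f g = norm (f - g)" "sgn f = inverse (norm f) *\<^sub>R f" "norm f = sqrt (inner f f)"
    by (simp_all add: dist_hspace_def sgn_hspace_def norm_hspace_def)
  show "uniformity = (INF e\<in>{0<..}. principal {(f, g :: hspace). dist f g < e})"
    by (rule uniformity_hspace_def)
  show "open U \<longleftrightarrow> (\<forall>f\<in>U. eventually (\<lambda>(f', g). f' = f \<longrightarrow> g \<in> U) uniformity)" for U :: "hspace set"
    by (rule open_hspace_def)
  show "inner f g = inner g f"
    by transfer (simp add: mult.commute)
  show "inner (f + g) k = inner f k + inner g k"
    by transfer (auto simp: H_rel_def distrib_right square_integrable_mult)
  show "inner (a *\<^sub>R f) g = a * inner f g"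
    by transfer (auto simp: H_rel_def mult.assoc)
  show "0 \<le> inner f f"
    by transfer simp
  show "inner f f = 0 \<longleftrightarrow> f = 0"
  proof transfer
    fix f assume "H_rel f f"
    then have f: "f \<in> square_integrable"
      by (simp add: H_rel_def)
    show "integral\<^sup>L weight_measure (\<lambda>\<omega>. f \<omega> * f \<omega>) = 0 \<longleftrightarrow> H_rel f (\<lambda>_. 0)"
      using f integral_nonneg_eq_0_iff_AE[OF square_integrable_mult[OF f f]]
      by (simp add: H_rel_def square_integrable_zero)
  qed
qed

end

text \<open>A function on \<open>(0, \<infinity>)\<close> with compact support is identified with its extension by zero.\<close>

definition test_functions :: "(real \<Rightarrow> real) set" where
  "test_functions =
     {f. (\<forall>k x. (deriv ^^ k) f differentiable at x) \<and>
         compact (closure {x. f x \<noteq> 0}) \<and> closure {x. f x \<noteq> 0} \<subseteq> {0<..}}"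

lemma test_functions_square_integrable: "test_functions \<subseteq> square_integrable"
proof
  fix f assume f: "f \<in> test_functions"
  define K where "K = closure {x. f x \<noteq> 0}"
  have K: "compact K" "K \<subseteq> {0<..}"
    using f by (auto simp: test_functions_def K_def)
  have "f differentiable at x" for x
    using f funpow_0[of deriv f] unfolding test_functions_def by (metis (mono_tags, lifting) mem_Collect_eq)
  then have cont: "continuous_on UNIV f"
    by (simp add: continuous_at_imp_continuous_on differentiable_imp_continuous_within)
  then have meas [measurable]: "f \<in> borel_measurable borel"
    by (rule borel_measurable_continuous_onI)
  have "integrable lborel (\<lambda>x. indicator K x *\<^sub>R (sqrt x * (f x)\<^sup>2))"
    by (intro borel_integrable_compact K(1) continuous_intros continuous_on_subset[OF cont]) auto
  moreover have "indicator K x *\<^sub>R (sqrt x * (f x)\<^sup>2) = indicator {0<..} x *\<^sub>R (sqrt x *\<^sub>R (f x)\<^sup>2)" for x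
    using K(2) closure_subset[of "{x. f x \<noteq> 0}"] unfolding K_def[symmetric]
    by (cases "f x = 0") (auto simp: indicator_def)
  ultimately have "integrable lborel (\<lambda>x. indicator {0<..} x *\<^sub>R (sqrt x *\<^sub>R (f x)\<^sup>2))"
    by (rule back_subst[where P = "integrable lborel", OF _ ext])
  then have "integrable (restrict_space lborel {0<..}) (\<lambda>x. sqrt x *\<^sub>R (f x)\<^sup>2)"
    by (subst integrable_restrict_space) auto
  moreover have "(\<lambda>x. (f x)\<^sup>2) \<in> borel_measurable (restrict_space lborel {0<..})"
    "sqrt \<in> borel_measurable (restrict_space lborel {0<..})"
    by (auto intro!: measurable_restrict_space1)
  moreover have "AE x in restrict_space lborel {0<..}. 0 \<le> sqrt (x::real)"
    by (subst AE_restrict_space_iff) auto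
  ultimately have "integrable weight_measure (\<lambda>x. (f x)\<^sup>2)"
    unfolding weight_measure_def by (subst integrable_density) auto
  moreover have "f \<in> borel_measurable weight_measure"
    unfolding weight_measure_def by (auto intro!: measurable_restrict_space1)
  ultimately show "f \<in> square_integrable"
    by (simp add: square_integrable_def)
qed

definition equil :: "real \<Rightarrow> real \<Rightarrow> real" where
  "equil \<mu> \<omega> = 1 / (\<omega> + \<mu>)"

definition coll_domain :: "real \<Rightarrow> (real \<times> real) set" where
  "coll_domain \<omega>0 = {(\<omega>1, \<omega>2). 0 < \<omega>1 \<and> 0 < \<omega>2 \<and> \<omega>0 < \<omega>1 + \<omega>2}"

definition coll_weight :: "real \<Rightarrow> real \<Rightarrow> real \<Rightarrow> real \<Rightarrow> real" where
  "coll_weight \<omega>0 \<omega>1 \<omega>2 \<omega>3 = Min {sqrt \<omega>0, sqrt \<omega>1, sqrt \<omega>2, sqrt \<omega>3} / sqrt \<omega>0"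

definition Gamma_integrand ::
  "real \<Rightarrow> (real \<Rightarrow> real) \<Rightarrow> (real \<Rightarrow> real) \<Rightarrow> real \<Rightarrow> real \<times> real \<Rightarrow> real" where
  "Gamma_integrand \<mu> g h \<omega>0 = (\<lambda>(\<omega>1, \<omega>2).
     let \<omega>3 = \<omega>1 + \<omega>2 - \<omega>0; n1 = equil \<mu> \<omega>1; n2 = equil \<mu> \<omega>2; n3 = equil \<mu> \<omega>3
     in coll_weight \<omega>0 \<omega>1 \<omega>2 \<omega>3 * n1 * n2 * n3 *
        (- g \<omega>0 * h \<omega>3 * (inverse n2 + inverse n1)
         + g \<omega>0 * h \<omega>1 * (inverse n3 - inverse n2)
         + g \<omega>0 * h \<omega>2 * (inverse n3 - inverse n1)
         + g \<omega>3 * h \<omega>1 * (inverse n1 - inverse n3)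
         + g \<omega>3 * h \<omega>2 * (inverse n2 - inverse n3)
         + g \<omega>1 * h \<omega>2 * (inverse n2 + inverse n1)))"

definition Q_integrand ::
  "real \<Rightarrow> (real \<Rightarrow> real) \<Rightarrow> (real \<Rightarrow> real) \<Rightarrow> (real \<Rightarrow> real) \<Rightarrow> real \<Rightarrow> real \<times> real \<Rightarrow> real" where
  "Q_integrand \<mu> g h l \<omega>0 = (\<lambda>(\<omega>1, \<omega>2).
     let \<omega>3 = \<omega>1 + \<omega>2 - \<omega>0;
         n0 = equil \<mu> \<omega>0; n1 = equil \<mu> \<omega>1; n2 = equil \<mu> \<omega>2; n3 = equil \<mu> \<omega>3
     in coll_weight \<omega>0 \<omega>1 \<omega>2 \<omega>3 * n1 * n2 * n3 *
        (inverse n3 * g \<omega>0 * h \<omega>1 * l \<omega>2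
         + inverse n0 * g \<omega>1 * h \<omega>2 * l \<omega>3
         - inverse n1 * g \<omega>0 * h \<omega>2 * l \<omega>3
         - inverse n2 * g \<omega>0 * h \<omega>1 * l \<omega>3))"

definition Gamma_formula :: "real \<Rightarrow> (real \<Rightarrow> real) \<Rightarrow> (real \<Rightarrow> real) \<Rightarrow> real \<Rightarrow> real" where
  "Gamma_formula \<mu> g h \<omega> = (LINT p:coll_domain \<omega>|lborel. Gamma_integrand \<mu> g h \<omega> p)"

definition Q_formula ::
  "real \<Rightarrow> (real \<Rightarrow> real) \<Rightarrow> (real \<Rightarrow> real) \<Rightarrow> (real \<Rightarrow> real) \<Rightarrow> real \<Rightarrow> real" where
  "Q_formula \<mu> g h l \<omega> = (LINT p:coll_domain \<omega>|lborel. Q_integrand \<mu> g h l \<omega> p)"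

definition bounded_trilinear :: "('a::real_normed_vector \<Rightarrow> 'a \<Rightarrow> 'a \<Rightarrow> 'a) \<Rightarrow> bool" where
  "bounded_trilinear T \<longleftrightarrow>
     (\<forall>y z. linear (\<lambda>x. T x y z)) \<and> (\<forall>x z. linear (\<lambda>y. T x y z)) \<and> (\<forall>x y. linear (\<lambda>z. T x y z)) \<and>
     (\<exists>K. \<forall>x y z. norm (T x y z) \<le> K * norm x * norm y * norm z)"

definition Gamma_extension :: "real \<Rightarrow> (hspace \<Rightarrow> hspace \<Rightarrow> hspace) \<Rightarrow> bool" where
  "Gamma_extension \<mu> G \<longleftrightarrow> bounded_bilinear G \<and>
     (\<forall>g\<in>test_functions. \<forall>h\<in>test_functions.
        Gamma_formula \<mu> g h \<in> square_integrable \<and>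
        G (to_H g) (to_H h) = to_H (Gamma_formula \<mu> g h))"

definition Q_extension :: "real \<Rightarrow> (hspace \<Rightarrow> hspace \<Rightarrow> hspace \<Rightarrow> hspace) \<Rightarrow> bool" where
  "Q_extension \<mu> T \<longleftrightarrow> bounded_trilinear T \<and>
     (\<forall>g\<in>test_functions. \<forall>h\<in>test_functions. \<forall>l\<in>test_functions.
        Q_formula \<mu> g h l \<in> square_integrable \<and>
        T (to_H g) (to_H h) (to_H l) = to_H (Q_formula \<mu> g h l))"

text \<open>\<open>THE\<close> is meaningful only where the extension exists and is unique; this has to be
  established along with any statement about these maps.\<close>

definition Gamma_H :: "real \<Rightarrow> hspace \<Rightarrow> hspace \<Rightarrow> hspace" where
  "Gamma_H \<mu> = (THE G. Gamma_extension \<mu> G)"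

definition Q_H :: "real \<Rightarrow> hspace \<Rightarrow> hspace \<Rightarrow> hspace \<Rightarrow> hspace" where
  "Q_H \<mu> = (THE T. Q_extension \<mu> T)"

end

theory Submission
  imports Defs
begin

text \<open>
  Both operators are controlled by one mechanism. Write $r(x) = x^{1/4}$ and $\hat g = r\,|g|$, so that
  the norm of $g$ in $H$ is the plain $L^2$ norm of $\hat g$. After multiplication by $r(\omega_0)$
  every summand of a collision integrand is bounded by a product
  $u_0(\omega_0)\,u_1(\omega_1)\,u_2(\omega_2)\,u_3(\omega_3)$ in which one factor is constantly $1$,
  one factor is a profile $\hat g$, hence in $L^2$, and the other two are in $L^1$. Two $L^1$ factors in
  two free variables and an $L^2$ factor whose argument is $\omega_0$ or a translate or reflection
  of it give an $L^2$ function of $\omega_0$: this is Cauchy--Schwarz followed by Tonelli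
  (\<open>schur_bounded_integral\<close>).

  The reduction to such products (\<open>Gamma_integrand_le\<close>, \<open>Q_integrand_le\<close>) uses two facts. The
  numerator $m$ of $\Omega$ is at most $r(\omega_i) r(\omega_j)$ for all $i, j$; together with
  conservation of energy, which bounds each frequency by the sum of two others, this trades the weight $m$
  for $r(\omega_a) r(\omega_b) r(\omega_c) / r(\omega_l)$ (\<open>le_fourth_root_mult\<close>). The factor $1/r$
  is what makes $p = n/r$ integrable at infinity, where $n$ itself only just fails to be. Secondly, in
  the two summands of $\Gamma$ that contain $g_0 h_1$ or $g_0 h_2$, the difference of two inverse
  equilibria must not be estimated by the triangle inequality: both remaining frequencies can be large
  at once. The difference equals the gap of two frequencies, and a fourth root of that gap can be
  absorbed by the weight (\<open>equil_mult_gap_le\<close>). For $Q$ only $n \hat g / r$ is needed, which is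
  integrable because $n/r$ is in $L^2$.

  As the bounds are absolute, the collision integral converges for almost every $\omega_0$ for all
  square-integrable inputs, and the extensions are given by the same formulas evaluated at arbitrary
  representatives. For test functions the profile is bounded, so the same products give convergence at
  every $\omega_0 > 0$. Uniqueness holds because test functions are dense: smooth bumps converge to
  indicators of intervals, a Dynkin argument reaches Borel sets, and simple functions reach all of $H$
  (\<open>closed_subspace_of_tests_UNIV\<close>).
\<close>

section \<open>Pointwise bounds for the collision kernels\<close>

abbreviation fourth_root :: "real \<Rightarrow> real" where
  "fourth_root x \<equiv> sqrt (sqrt x)"

text \<open>The square of the fourth root is the weight $\sqrt\omega$, so the norm of \<open>g\<close> becomes the unweighted $L^2$ norm of its profile. Extension by zero lets all integrals run over the whole line.\<close>

definition profile :: "(real \<Rightarrow> real) \<Rightarrow> real \<Rightarrow> real" where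
  "profile g x = (if x > 0 then fourth_root x * \<bar>g x\<bar> else 0)"

definition decay :: "real \<Rightarrow> real \<Rightarrow> real" where
  "decay \<mu> x = (if x > 0 then equil \<mu> x / fourth_root x else 0)"

text \<open>A profile lies only in $L^2$. The factors \<open>equil\<close> and \<open>decay\<close>, being square integrable, turn it into an $L^1$ function.\<close>

definition damped :: "real \<Rightarrow> (real \<Rightarrow> real) \<Rightarrow> real \<Rightarrow> real" where
  "damped \<mu> g x = equil \<mu> x * profile g x"

definition smoothed :: "real \<Rightarrow> (real \<Rightarrow> real) \<Rightarrow> real \<Rightarrow> real" where
  "smoothed \<mu> g x = decay \<mu> x * profile g x"

text \<open>A minimum of square roots is below the geometric mean of any two of them; this lets the collision weight be distributed over whichever frequencies need it.\<close>

lemma le_geometric_mean: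
  fixes m a b :: real
  assumes "0 \<le> m" "m \<le> sqrt a" "m \<le> sqrt b"
  shows "m \<le> fourth_root a * fourth_root b"
proof -
  have "sqrt (m * m) \<le> sqrt (sqrt a * sqrt b)"
    using assms order_trans[OF assms(1,2)] by (intro real_sqrt_le_mono mult_mono) simp_all
  then show ?thesis
    using assms(1) by (simp add: real_sqrt_mult)
qed

text \<open>One of \<open>a\<close> and \<open>b\<close> is at least half of \<open>l\<close>, so its fourth root dominates that of \<open>l\<close>; the weight \<open>m\<close> pays for the two others. In the applications \<open>l\<close> is the frequency, or the gap between two frequencies, at which decay is to be gained. Repetitions such as \<open>a = c\<close> are intended: they occur when $g_0$ is one of the factors.\<close>

lemma le_fourth_root_mult:
  fixes m a b c l :: real
  assumes "0 \<le> m" "m \<le> sqrt a" "m \<le> sqrt b" "m \<le> sqrt c" "0 \<le> a" "0 \<le> b" "0 \<le> c" "0 \<le> l" "l \<le> a + b"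
  shows "m * fourth_root l \<le> 2 * (fourth_root a * fourth_root b * fourth_root c)"
proof -
  have two: "fourth_root l \<le> 2 * fourth_root d" if "l \<le> 2 * d" "0 \<le> d" for d
  proof -
    have "fourth_root l \<le> fourth_root (2 ^ 4 * d)"
      using that by (intro real_sqrt_le_mono) auto
    also have "\<dots> = 2 * fourth_root d"
      by (simp add: real_sqrt_mult)
    finally show ?thesis .
  qed
  have "m * fourth_root l \<le> (fourth_root b * fourth_root c) * (2 * fourth_root a)" if "l \<le> 2 * a"
    using assms by (intro mult_mono' le_geometric_mean two that) auto
  moreover have "m * fourth_root l \<le> (fourth_root a * fourth_root c) * (2 * fourth_root b)" if "l \<le> 2 * b"
    using assms by (intro mult_mono' le_geometric_mean two that) auto
  moreover have "l \<le> 2 * a \<or> l \<le> 2 * b"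
    using assms by linarith
  ultimately show ?thesis
    by (auto simp: mult_ac)
qed

lemma inverse_equil: "0 < \<mu> \<Longrightarrow> 0 < x \<Longrightarrow> inverse (equil \<mu> x) = x + \<mu>"
  by (simp add: equil_def)

lemma equil_pos: "0 < \<mu> \<Longrightarrow> 0 < x \<Longrightarrow> 0 < equil \<mu> x"
  by (simp add: equil_def)

lemma equil_mult_add: "0 < \<mu> \<Longrightarrow> 0 < x \<Longrightarrow> equil \<mu> x * (x + \<mu>) = 1"
  by (simp add: equil_def)

lemma equil_gap_le:
  assumes "0 < \<mu>" "0 < x" "0 < y"
  shows "equil \<mu> x * equil \<mu> y * \<bar>x - y\<bar> \<le> equil \<mu> x + equil \<mu> y"
proof -
  have "equil \<mu> x * equil \<mu> y * \<bar>x - y\<bar> \<le> equil \<mu> x * equil \<mu> y * ((y + \<mu>) + (x + \<mu>))"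
    using assms by (intro mult_left_mono) (auto simp: equil_def)
  also have "\<dots> = equil \<mu> x + equil \<mu> y"
    using equil_mult_add[of \<mu> x] equil_mult_add[of \<mu> y] assms by (simp add: equil_def field_simps)
  finally show ?thesis .
qed

lemma fourth_root_power4: "0 \<le> x \<Longrightarrow> fourth_root x ^ 4 = x"
  using power_mult[of "fourth_root x" 2 2] by simp

text \<open>If \<open>x \<le> y\<close> and \<open>d\<close> is the fourth root of the gap, then $d^4 = d \cdot d^3$, and $n(y)\,d^3 \le y^{-1}\,y^{3/4} \le x^{-1/4}$. So all but a fourth root of the gap is absorbed by the equilibrium at the larger frequency, which even leaves the decay of $n(x)\,x^{-1/4}$. Compared with \<open>equil_gap_le\<close> this keeps integrability when both frequencies are large.\<close>

lemma equil_mult_gap_le: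
  assumes "0 < \<mu>" "0 < x" "0 < y"
  shows "equil \<mu> x * equil \<mu> y * \<bar>y - x\<bar> \<le> (decay \<mu> x + decay \<mu> y) * fourth_root \<bar>y - x\<bar>"
proof -
  have *: "equil \<mu> x * equil \<mu> y * \<bar>y - x\<bar> \<le> decay \<mu> x * fourth_root \<bar>y - x\<bar>"
    if "0 < x" "x \<le> y" for x y
  proof -
    define d where "d = fourth_root \<bar>y - x\<bar>"
    have d: "0 \<le> d" "d \<le> fourth_root y" and d4: "\<bar>y - x\<bar> = d ^ 4"
      using that fourth_root_power4[of "\<bar>y - x\<bar>"] by (auto simp: d_def)
    have "fourth_root x * d ^ 3 \<le> fourth_root y * fourth_root y ^ 3"
      using that d by (intro mult_mono power_mono) auto
    also have "\<dots> = fourth_root y ^ 4"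
      by (simp only: power3_eq_cube power4_eq_xxxx mult.assoc)
    also have "\<dots> = y"
      using fourth_root_power4[of y] that by simp
    finally have "fourth_root x * d ^ 3 \<le> y + \<mu>"
      using assms(1) by simp
    then have "fourth_root x * d ^ 3 * equil \<mu> y \<le> 1"
      using that assms(1) by (simp add: equil_def)
    then have "equil \<mu> y * d ^ 3 \<le> 1 / fourth_root x"
      using that by (simp add: field_simps)
    then have "equil \<mu> x * d * (equil \<mu> y * d ^ 3) \<le> equil \<mu> x * d * (1 / fourth_root x)"
      using equil_pos[OF assms(1) that(1)] d by (intro mult_left_mono) auto
    then show ?thesis
      unfolding d_def[symmetric] unfolding d4 decay_def using that(1)
      by (simp add: power4_eq_xxxx power3_eq_cube mult_ac)
  qed
  have nn: "0 \<le> decay \<mu> x" "0 \<le> decay \<mu> y"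
    using assms by (auto simp: decay_def equil_def)
  show ?thesis
  proof (cases "x \<le> y")
    case True
    have "decay \<mu> x * fourth_root \<bar>y - x\<bar> \<le> (decay \<mu> x + decay \<mu> y) * fourth_root \<bar>y - x\<bar>"
      using nn by (intro mult_right_mono) auto
    with *[OF assms(2) True] show ?thesis by linarith
  next
    case False
    have "decay \<mu> y * fourth_root \<bar>y - x\<bar> \<le> (decay \<mu> x + decay \<mu> y) * fourth_root \<bar>y - x\<bar>"
      using nn by (intro mult_right_mono) auto
    moreover have "equil \<mu> x * equil \<mu> y * \<bar>y - x\<bar> \<le> decay \<mu> y * fourth_root \<bar>y - x\<bar>"
      using *[of y x] assms False by (simp add: abs_minus_commute mult_ac)
    ultimately show ?thesis by linarith
  qed
qed

text \<open>A quadruple stands for the product of four functions, evaluated at the frequencies $\omega_0, \dots, \omega_3$ of one collision.\<close>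

type_synonym quad = "(real \<Rightarrow> real) \<times> (real \<Rightarrow> real) \<times> (real \<Rightarrow> real) \<times> (real \<Rightarrow> real)"

definition quad_product :: "real \<Rightarrow> real \<Rightarrow> real \<Rightarrow> real \<Rightarrow> quad \<Rightarrow> real" where
  "quad_product w0 w1 w2 w3 = (\<lambda>(u0, u1, u2, u3). u0 w0 * u1 w1 * u2 w2 * u3 w3)"

text \<open>The six pairs of products belong, in order, to the summands $g_0h_3$, $g_0h_1$, $g_0h_2$, $g_3h_1$, $g_3h_2$ and $g_1h_2$ of the bracket.\<close>

definition Gamma_terms :: "real \<Rightarrow> (real \<Rightarrow> real) \<Rightarrow> (real \<Rightarrow> real) \<Rightarrow> quad list" where
  "Gamma_terms \<mu> g h =
    (let G = profile g; H = profile h; dG = damped \<mu> g; dH = damped \<mu> h; p = decay \<mu>; e = (\<lambda>_. 1)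
     in [(G, p, e, dH), (G, e, p, dH), (G, dH, p, e), (G, dH, e, p), (G, p, dH, e), (G, e, dH, p),
         (e, dH, p, G), (e, H, p, dG), (e, p, dH, G), (e, p, H, dG), (e, dG, H, p), (e, G, dH, p)])"

text \<open>The second and third product both come from $g_1h_2\ell_3$, because $n_0^{-1} \le n_1^{-1} + n_2^{-1}$.\<close>

definition Q_terms :: "real \<Rightarrow> (real \<Rightarrow> real) \<Rightarrow> (real \<Rightarrow> real) \<Rightarrow> (real \<Rightarrow> real) \<Rightarrow> quad list" where
  "Q_terms \<mu> g h l =
    (let G = profile g; H = profile h; sG = smoothed \<mu> g; sH = smoothed \<mu> h; sL = smoothed \<mu> l;
         e = (\<lambda>_. 1)
     in [(G, sH, sL, e), (e, sG, H, sL), (e, G, sH, sL), (G, e, sH, sL), (G, sH, e, sL)])"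

lemma weighted_quotient_le:
  fixes m r s t X :: real
  assumes "0 < r" "0 < s" "m * s \<le> 2 * (t * r)" "0 \<le> X"
  shows "m / r * X \<le> 2 * (t * X / s)"
proof -
  have "m / r \<le> 2 * t / s"
    using assms by (simp add: field_simps)
  then show ?thesis
    using mult_right_mono[OF _ assms(4)] by fastforce
qed

text \<open>One collision, with the last frequency as a variable of its own so that the roles of the four frequencies stay visible.\<close>

locale collision =
  fixes \<mu> w0 w1 w2 w3 :: real
  assumes mu: "0 < \<mu>" and pos: "0 < w0" "0 < w1" "0 < w2" "0 < w3" and conservation: "w3 = w1 + w2 - w0"
begin

definition m where "m = Min {sqrt w0, sqrt w1, sqrt w2, sqrt w3}"

lemma m: "0 \<le> m" "m \<le> sqrt w0" "m \<le> sqrt w1" "m \<le> sqrt w2" "m \<le> sqrt w3"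
  using pos by (auto simp: m_def)

lemma fourth_root_mult_coll_weight:
  "fourth_root w0 * \<bar>coll_weight w0 w1 w2 w3 * x\<bar> = m / fourth_root w0 * \<bar>x\<bar>"
proof -
  have "sqrt w0 = fourth_root w0 * fourth_root w0"
    using pos by simp
  then show ?thesis
    unfolding coll_weight_def m_def[symmetric] using m(1) pos
    by (simp add: abs_mult divide_simps)
qed

text \<open>Every summand is treated alike: choose the frequency $\omega_l$ (or the gap) that has to supply decay, apply \<open>le_fourth_root_mult\<close> with the frequencies carried by the functions, and divide by $r(\omega_l)$. For $g_0h_3$ the inverse equilibria cancel exactly and $\omega_1$, $\omega_2$ supply the decay; for $g_3h_1$, $g_3h_2$ and $g_1h_2$ the decay comes from the frequency that carries no function. Only $g_0h_1$ and $g_0h_2$ require the gap itself.\<close>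

lemma Gamma_integrand_le:
  "fourth_root w0 * \<bar>Gamma_integrand \<mu> g h w0 (w1, w2)\<bar> \<le>
     2 * (\<Sum>t\<leftarrow>Gamma_terms \<mu> g h. quad_product w0 w1 w2 w3 t)"
proof -
  define n1 n2 n3 where n: "n1 = equil \<mu> w1" "n2 = equil \<mu> w2" "n3 = equil \<mu> w3"
  define r0 r1 r2 r3 where r: "r0 = fourth_root w0" "r1 = fourth_root w1" "r2 = fourth_root w2" "r3 = fourth_root w3"
  define a0 a1 a3 where a: "a0 = \<bar>g w0\<bar>" "a1 = \<bar>g w1\<bar>" "a3 = \<bar>g w3\<bar>"
  define b1 b2 b3 where b: "b1 = \<bar>h w1\<bar>" "b2 = \<bar>h w2\<bar>" "b3 = \<bar>h w3\<bar>"
  have npos: "0 < n1" "0 < n2" "0 < n3"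
    using equil_pos[OF mu] pos by (simp_all add: n)
  have rpos: "0 < r0" "0 < r1" "0 < r2" "0 < r3"
    using pos by (simp_all add: r)
  have abpos: "0 \<le> a0" "0 \<le> a1" "0 \<le> a3" "0 \<le> b1" "0 \<le> b2" "0 \<le> b3"
    by (simp_all add: a b)
  note nonneg = npos[THEN less_imp_le] rpos[THEN less_imp_le] abpos
  have inv: "inverse n1 = w1 + \<mu>" "inverse n2 = w2 + \<mu>" "inverse n3 = w3 + \<mu>"
    using inverse_equil[OF mu] pos by (simp_all add: n)
  define x where "x = n1 * n2 * n3 *
        (- g w0 * h w3 * (inverse n2 + inverse n1)
         + g w0 * h w1 * (inverse n3 - inverse n2)
         + g w0 * h w2 * (inverse n3 - inverse n1)
         + g w3 * h w1 * (inverse n1 - inverse n3)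
         + g w3 * h w2 * (inverse n2 - inverse n3)
         + g w1 * h w2 * (inverse n2 + inverse n1))"
  have x_le: "\<bar>x\<bar> \<le> n1 * n2 * n3 * (a0 * b3 * (inverse n2 + inverse n1) + a0 * b1 * \<bar>w3 - w2\<bar>
      + a0 * b2 * \<bar>w3 - w1\<bar> + a3 * b1 * \<bar>w1 - w3\<bar> + a3 * b2 * \<bar>w2 - w3\<bar>
      + a1 * b2 * (inverse n2 + inverse n1))"
  proof -
    have "\<bar>- p + q + s + t + u + v\<bar> \<le> \<bar>p\<bar> + \<bar>q\<bar> + \<bar>s\<bar> + \<bar>t\<bar> + \<bar>u\<bar> + \<bar>v\<bar>" for p q s t u v :: real
      by linarith
    from this[of "g w0 * h w3 * (inverse n2 + inverse n1)" "g w0 * h w1 * (inverse n3 - inverse n2)"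
        "g w0 * h w2 * (inverse n3 - inverse n1)" "g w3 * h w1 * (inverse n1 - inverse n3)"
        "g w3 * h w2 * (inverse n2 - inverse n3)" "g w1 * h w2 * (inverse n2 + inverse n1)"]
    have "\<bar>- g w0 * h w3 * (inverse n2 + inverse n1) + g w0 * h w1 * (inverse n3 - inverse n2)
         + g w0 * h w2 * (inverse n3 - inverse n1) + g w3 * h w1 * (inverse n1 - inverse n3)
         + g w3 * h w2 * (inverse n2 - inverse n3) + g w1 * h w2 * (inverse n2 + inverse n1)\<bar> \<le>
        \<bar>g w0 * h w3 * (inverse n2 + inverse n1)\<bar> + \<bar>g w0 * h w1 * (inverse n3 - inverse n2)\<bar>
         + \<bar>g w0 * h w2 * (inverse n3 - inverse n1)\<bar> + \<bar>g w3 * h w1 * (inverse n1 - inverse n3)\<bar>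
         + \<bar>g w3 * h w2 * (inverse n2 - inverse n3)\<bar> + \<bar>g w1 * h w2 * (inverse n2 + inverse n1)\<bar>"
      by simp
    also have "\<dots> = a0 * b3 * (inverse n2 + inverse n1) + a0 * b1 * \<bar>w3 - w2\<bar>
      + a0 * b2 * \<bar>w3 - w1\<bar> + a3 * b1 * \<bar>w1 - w3\<bar> + a3 * b2 * \<bar>w2 - w3\<bar>
      + a1 * b2 * (inverse n2 + inverse n1)"
      using pos mu by (simp add: abs_mult a b inv)
    finally show ?thesis
      unfolding x_def abs_mult[of "n1 * n2 * n3"] using npos by (intro mult_mono) auto
  qed
  have "profile g w0 = r0 * a0" "profile g w1 = r1 * a1" "profile g w3 = r3 * a3"
    "profile h w1 = r1 * b1" "profile h w2 = r2 * b2" "profile h w3 = r3 * b3"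
    "decay \<mu> w1 = n1 / r1" "decay \<mu> w2 = n2 / r2" "decay \<mu> w3 = n3 / r3"
    using pos by (simp_all add: profile_def decay_def a b n r)
  then have terms: "(\<Sum>t\<leftarrow>Gamma_terms \<mu> g h. quad_product w0 w1 w2 w3 t) =
      r0 * a0 * (n1 / r1) * (n3 * (r3 * b3)) + r0 * a0 * (n2 / r2) * (n3 * (r3 * b3)) +
      (r0 * a0 * (n1 * (r1 * b1)) * (n2 / r2) + r0 * a0 * (n1 * (r1 * b1)) * (n3 / r3)) +
      (r0 * a0 * (n2 * (r2 * b2)) * (n1 / r1) + r0 * a0 * (n2 * (r2 * b2)) * (n3 / r3)) +
      (n1 * (r1 * b1) * (n2 / r2) * (r3 * a3) + r1 * b1 * (n2 / r2) * (n3 * (r3 * a3))) +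
      (n1 / r1 * (n2 * (r2 * b2)) * (r3 * a3) + n1 / r1 * (r2 * b2) * (n3 * (r3 * a3))) +
      (n1 * (r1 * a1) * (r2 * b2) * (n3 / r3) + r1 * a1 * (n2 * (r2 * b2)) * (n3 / r3))"
    by (simp add: Gamma_terms_def quad_product_def Let_def damped_def n[symmetric] mult_ac)
  have le: "m / r0 * X \<le> 2 * (t * X / s)" if "m * s \<le> 2 * (t * r0)" "0 < s" "0 \<le> X" for s t X
    using weighted_quotient_le[of r0 s m t X] that rpos by blast
  have gap: "n1 * n3 * \<bar>w1 - w3\<bar> \<le> n1 + n3" "n2 * n3 * \<bar>w2 - w3\<bar> \<le> n2 + n3"
    using equil_gap_le[of \<mu> w1 w3] equil_gap_le[of \<mu> w2 w3] mu pos by (simp_all add: n)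
  have A: "m / r0 * (n1 * n2 * n3 * (a0 * b3 * (inverse n2 + inverse n1))) \<le>
      2 * (r0 * a0 * (n1 / r1) * (n3 * (r3 * b3)) + r0 * a0 * (n2 / r2) * (n3 * (r3 * b3)))"
  proof -
    have "m * r1 \<le> 2 * (r0 * r3 * r0)" "m * r2 \<le> 2 * (r0 * r3 * r0)"
      using le_fourth_root_mult[of m w0 w3 w0 w1] le_fourth_root_mult[of m w0 w3 w0 w2] m pos conservation by (auto simp: r)
    then have "m / r0 * (a0 * b3 * n3 * n1) \<le> 2 * (r0 * r3 * (a0 * b3 * n3 * n1) / r1)"
      "m / r0 * (a0 * b3 * n3 * n2) \<le> 2 * (r0 * r3 * (a0 * b3 * n3 * n2) / r2)"
      using le[of r1 "r0 * r3" "a0 * b3 * n3 * n1"] le[of r2 "r0 * r3" "a0 * b3 * n3 * n2"] nonneg rpos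
      by simp_all
    moreover have "n1 * n2 * n3 * (a0 * b3 * (inverse n2 + inverse n1)) = a0 * b3 * n3 * n1 + a0 * b3 * n3 * n2"
      using npos by (simp add: field_simps)
    ultimately show ?thesis
      by (simp add: algebra_simps)
  qed
  (* Here both \<open>w2\<close> and \<open>w3\<close> may be large, so the cancellation in
     \<open>w3 - w2 = w1 - w0\<close> has to be used; the case of a vanishing gap is separate because the
     bound divides by its fourth root. *)
  have B: "m / r0 * (n1 * n2 * n3 * (a0 * b1 * \<bar>w3 - w2\<bar>)) \<le>
      2 * (r0 * a0 * (n1 * (r1 * b1)) * (n2 / r2) + r0 * a0 * (n1 * (r1 * b1)) * (n3 / r3))"
  proof (cases "w3 = w2")
    case False
    define s where "s = fourth_root \<bar>w3 - w2\<bar>"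
    have s: "0 < s" using False by (simp add: s_def)
    have gap_s: "n2 * n3 * \<bar>w3 - w2\<bar> / s \<le> n2 / r2 + n3 / r3"
      using equil_mult_gap_le[of \<mu> w2 w3] mu pos s by (simp add: decay_def n r s_def pos_divide_le_eq)
    have "m * s \<le> 2 * (r0 * r1 * r0)"
      using le_fourth_root_mult[of m w0 w1 w0 "\<bar>w3 - w2\<bar>"] m pos conservation by (auto simp: r s_def)
    then have "m / r0 * (n1 * n2 * n3 * (a0 * b1 * \<bar>w3 - w2\<bar>)) \<le>
        2 * (r0 * r1 * (n1 * n2 * n3 * (a0 * b1 * \<bar>w3 - w2\<bar>)) / s)"
      using s nonneg by (intro le) simp_all
    also have "\<dots> = 2 * (r0 * r1 * n1 * a0 * b1 * (n2 * n3 * \<bar>w3 - w2\<bar> / s))"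
      by simp
    also have "\<dots> \<le> 2 * (r0 * r1 * n1 * a0 * b1 * (n2 / r2 + n3 / r3))"
      using gap_s nonneg by (intro mult_left_mono) simp_all
    also have "\<dots> = 2 * (r0 * a0 * (n1 * (r1 * b1)) * (n2 / r2) + r0 * a0 * (n1 * (r1 * b1)) * (n3 / r3))"
      by (simp only: ring_distribs mult_ac)
    finally show ?thesis .
  qed (use nonneg in simp)
  have C: "m / r0 * (n1 * n2 * n3 * (a0 * b2 * \<bar>w3 - w1\<bar>)) \<le>
      2 * (r0 * a0 * (n2 * (r2 * b2)) * (n1 / r1) + r0 * a0 * (n2 * (r2 * b2)) * (n3 / r3))"
  proof (cases "w3 = w1")
    case False
    define s where "s = fourth_root \<bar>w3 - w1\<bar>"
    have s: "0 < s" using False by (simp add: s_def)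
    have gap_s: "n1 * n3 * \<bar>w3 - w1\<bar> / s \<le> n1 / r1 + n3 / r3"
      using equil_mult_gap_le[of \<mu> w1 w3] mu pos s by (simp add: decay_def n r s_def pos_divide_le_eq)
    have "m * s \<le> 2 * (r0 * r2 * r0)"
      using le_fourth_root_mult[of m w0 w2 w0 "\<bar>w3 - w1\<bar>"] m pos conservation by (auto simp: r s_def)
    then have "m / r0 * (n1 * n2 * n3 * (a0 * b2 * \<bar>w3 - w1\<bar>)) \<le>
        2 * (r0 * r2 * (n1 * n2 * n3 * (a0 * b2 * \<bar>w3 - w1\<bar>)) / s)"
      using s nonneg by (intro le) simp_all
    also have "\<dots> = 2 * (r0 * r2 * n2 * a0 * b2 * (n1 * n3 * \<bar>w3 - w1\<bar> / s))"
      by simp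
    also have "\<dots> \<le> 2 * (r0 * r2 * n2 * a0 * b2 * (n1 / r1 + n3 / r3))"
      using gap_s nonneg by (intro mult_left_mono) simp_all
    also have "\<dots> = 2 * (r0 * a0 * (n2 * (r2 * b2)) * (n1 / r1) + r0 * a0 * (n2 * (r2 * b2)) * (n3 / r3))"
      by (simp only: ring_distribs mult_ac)
    finally show ?thesis .
  qed (use nonneg in simp)
  have D: "m / r0 * (n1 * n2 * n3 * (a3 * b1 * \<bar>w1 - w3\<bar>)) \<le>
      2 * (n1 * (r1 * b1) * (n2 / r2) * (r3 * a3) + r1 * b1 * (n2 / r2) * (n3 * (r3 * a3)))"
  proof -
    have "m * r2 \<le> 2 * (r1 * r3 * r0)"
      using le_fourth_root_mult[of m w0 w3 w1 w2] m pos conservation by (auto simp: r mult_ac)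
    then have "m / r0 * (n1 * n2 * n3 * (a3 * b1 * \<bar>w1 - w3\<bar>)) \<le>
        2 * (r1 * r3 * (n1 * n2 * n3 * (a3 * b1 * \<bar>w1 - w3\<bar>)) / r2)"
      using nonneg rpos by (intro le) simp_all
    also have "\<dots> = 2 * (r1 * r3 * a3 * b1 * (n2 / r2) * (n1 * n3 * \<bar>w1 - w3\<bar>))"
      by simp
    also have "\<dots> \<le> 2 * (r1 * r3 * a3 * b1 * (n2 / r2) * (n1 + n3))"
      using nonneg gap(1) by (intro mult_left_mono) simp_all
    also have "\<dots> = 2 * (n1 * (r1 * b1) * (n2 / r2) * (r3 * a3) + r1 * b1 * (n2 / r2) * (n3 * (r3 * a3)))"
      by (simp only: ring_distribs mult_ac)
    finally show ?thesis .
  qed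
  have E: "m / r0 * (n1 * n2 * n3 * (a3 * b2 * \<bar>w2 - w3\<bar>)) \<le>
      2 * (n1 / r1 * (n2 * (r2 * b2)) * (r3 * a3) + n1 / r1 * (r2 * b2) * (n3 * (r3 * a3)))"
  proof -
    have "m * r1 \<le> 2 * (r2 * r3 * r0)"
      using le_fourth_root_mult[of m w0 w3 w2 w1] m pos conservation by (auto simp: r mult_ac)
    then have "m / r0 * (n1 * n2 * n3 * (a3 * b2 * \<bar>w2 - w3\<bar>)) \<le>
        2 * (r2 * r3 * (n1 * n2 * n3 * (a3 * b2 * \<bar>w2 - w3\<bar>)) / r1)"
      using nonneg rpos by (intro le) simp_all
    also have "\<dots> = 2 * (r2 * r3 * a3 * b2 * (n1 / r1) * (n2 * n3 * \<bar>w2 - w3\<bar>))"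
      by simp
    also have "\<dots> \<le> 2 * (r2 * r3 * a3 * b2 * (n1 / r1) * (n2 + n3))"
      using nonneg gap(2) by (intro mult_left_mono) simp_all
    also have "\<dots> = 2 * (n1 / r1 * (n2 * (r2 * b2)) * (r3 * a3) + n1 / r1 * (r2 * b2) * (n3 * (r3 * a3)))"
      by (simp only: ring_distribs mult_ac)
    finally show ?thesis .
  qed
  have F: "m / r0 * (n1 * n2 * n3 * (a1 * b2 * (inverse n2 + inverse n1))) \<le>
      2 * (n1 * (r1 * a1) * (r2 * b2) * (n3 / r3) + r1 * a1 * (n2 * (r2 * b2)) * (n3 / r3))"
  proof -
    have "m * r3 \<le> 2 * (r1 * r2 * r0)"
      using le_fourth_root_mult[of m w1 w2 w0 w3] m pos conservation by (auto simp: r mult_ac)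
    then have "m / r0 * (a1 * b2 * n3 * (n1 + n2)) \<le> 2 * (r1 * r2 * (a1 * b2 * n3 * (n1 + n2)) / r3)"
      using nonneg rpos by (intro le) simp_all
    moreover have "n1 * n2 * n3 * (a1 * b2 * (inverse n2 + inverse n1)) = a1 * b2 * n3 * (n1 + n2)"
      using npos by (simp add: field_simps)
    ultimately show ?thesis
      by (simp add: algebra_simps add_divide_distrib)
  qed
  have "fourth_root w0 * \<bar>Gamma_integrand \<mu> g h w0 (w1, w2)\<bar> = m / r0 * \<bar>x\<bar>"
    unfolding r(1) fourth_root_mult_coll_weight[symmetric] Gamma_integrand_def x_def
    by (simp add: Let_def n conservation[symmetric] mult.assoc)
  also have "\<dots> \<le> m / r0 * (n1 * n2 * n3 * (a0 * b3 * (inverse n2 + inverse n1) + a0 * b1 * \<bar>w3 - w2\<bar>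
      + a0 * b2 * \<bar>w3 - w1\<bar> + a3 * b1 * \<bar>w1 - w3\<bar> + a3 * b2 * \<bar>w2 - w3\<bar>
      + a1 * b2 * (inverse n2 + inverse n1)))"
    using x_le rpos m by (intro mult_left_mono) auto
  also have "\<dots> = m / r0 * (n1 * n2 * n3 * (a0 * b3 * (inverse n2 + inverse n1))) +
      m / r0 * (n1 * n2 * n3 * (a0 * b1 * \<bar>w3 - w2\<bar>)) + m / r0 * (n1 * n2 * n3 * (a0 * b2 * \<bar>w3 - w1\<bar>)) +
      m / r0 * (n1 * n2 * n3 * (a3 * b1 * \<bar>w1 - w3\<bar>)) + m / r0 * (n1 * n2 * n3 * (a3 * b2 * \<bar>w2 - w3\<bar>)) +
      m / r0 * (n1 * n2 * n3 * (a1 * b2 * (inverse n2 + inverse n1)))"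
    by (simp only: distrib_left)
  also note add_mono[OF add_mono[OF add_mono[OF add_mono[OF add_mono[OF A B] C] D] E] F]
  finally show ?thesis
    unfolding terms by (simp only: distrib_left add.assoc)
qed

text \<open>The weight is spent on the square root of $\omega_0$ for the terms that contain $g_0$, and on $r(\omega_0) r(\omega_1)$ or $r(\omega_0) r(\omega_2)$ for $g_1h_2\ell_3$, which leaves exactly the fourth roots that the profiles require.\<close>

lemma Q_integrand_le:
  "fourth_root w0 * \<bar>Q_integrand \<mu> g h l w0 (w1, w2)\<bar> \<le>
     (\<Sum>t\<leftarrow>Q_terms \<mu> g h l. quad_product w0 w1 w2 w3 t)"
proof -
  define n1 n2 n3 where n: "n1 = equil \<mu> w1" "n2 = equil \<mu> w2" "n3 = equil \<mu> w3"
  define r0 r1 r2 r3 where r: "r0 = fourth_root w0" "r1 = fourth_root w1" "r2 = fourth_root w2" "r3 = fourth_root w3"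
  define a0 a1 where a: "a0 = \<bar>g w0\<bar>" "a1 = \<bar>g w1\<bar>"
  define b1 b2 where b: "b1 = \<bar>h w1\<bar>" "b2 = \<bar>h w2\<bar>"
  define c2 c3 where c: "c2 = \<bar>l w2\<bar>" "c3 = \<bar>l w3\<bar>"
  have npos: "0 < n1" "0 < n2" "0 < n3"
    using equil_pos[OF mu] pos by (simp_all add: n)
  have rpos: "0 < r0" "0 < r1" "0 < r2" "0 < r3"
    using pos by (simp_all add: r)
  have abcpos: "0 \<le> a0" "0 \<le> a1" "0 \<le> b1" "0 \<le> b2" "0 \<le> c2" "0 \<le> c3"
    by (simp_all add: a b c)
  note nonneg = npos[THEN less_imp_le] rpos[THEN less_imp_le] abcpos
  have inv: "inverse n1 = w1 + \<mu>" "inverse n2 = w2 + \<mu>" "inverse n3 = w3 + \<mu>"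
    "inverse (equil \<mu> w0) = w0 + \<mu>"
    using inverse_equil[OF mu] pos by (simp_all add: n)
  define x where "x = n1 * n2 * n3 *
        (inverse n3 * g w0 * h w1 * l w2
         + inverse (equil \<mu> w0) * g w1 * h w2 * l w3
         - inverse n1 * g w0 * h w2 * l w3
         - inverse n2 * g w0 * h w1 * l w3)"
  have "inverse (equil \<mu> w0) \<le> inverse n1 + inverse n2"
    unfolding inv using conservation pos mu by linarith
  moreover have "\<bar>inverse n3 * g w0 * h w1 * l w2
         + inverse (equil \<mu> w0) * g w1 * h w2 * l w3
         - inverse n1 * g w0 * h w2 * l w3
         - inverse n2 * g w0 * h w1 * l w3\<bar> \<le>
      inverse n3 * a0 * b1 * c2 + inverse (equil \<mu> w0) * (a1 * b2 * c3)
         + inverse n1 * a0 * b2 * c3 + inverse n2 * a0 * b1 * c3"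
  proof -
    have tri: "\<bar>p + q - s - t\<bar> \<le> \<bar>p\<bar> + \<bar>q\<bar> + \<bar>s\<bar> + \<bar>t\<bar>" for p q s t :: real
      by linarith
    show ?thesis
      using npos equil_pos[OF mu pos(1)] by (intro order_trans[OF tri]) (simp add: abs_mult a b c mult.assoc)
  qed
  ultimately have "\<bar>inverse n3 * g w0 * h w1 * l w2
         + inverse (equil \<mu> w0) * g w1 * h w2 * l w3
         - inverse n1 * g w0 * h w2 * l w3
         - inverse n2 * g w0 * h w1 * l w3\<bar> \<le>
      inverse n3 * a0 * b1 * c2 + (inverse n1 + inverse n2) * (a1 * b2 * c3)
         + inverse n1 * a0 * b2 * c3 + inverse n2 * a0 * b1 * c3"
    using mult_right_mono[of "inverse (equil \<mu> w0)" "inverse n1 + inverse n2" "a1 * b2 * c3"] nonneg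
    by simp
  then have "\<bar>x\<bar> \<le> n1 * n2 * n3 * (inverse n3 * a0 * b1 * c2 + (inverse n1 + inverse n2) * (a1 * b2 * c3)
         + inverse n1 * a0 * b2 * c3 + inverse n2 * a0 * b1 * c3)"
    unfolding x_def abs_mult[of "n1 * n2 * n3"] using npos by (intro mult_mono) auto
  also have "\<dots> = n1 * n2 * a0 * b1 * c2 + n2 * n3 * (a1 * b2 * c3) + n1 * n3 * (a1 * b2 * c3)
         + n2 * n3 * a0 * b2 * c3 + n1 * n3 * a0 * b1 * c3"
    using npos by (simp add: field_simps)
  finally have x_le: "\<bar>x\<bar> \<le> \<dots>" .
  have m_le: "m / r0 \<le> r0" "m / r0 \<le> r1" "m / r0 \<le> r2"
    using m pos le_geometric_mean[of m w0 w0] le_geometric_mean[of m w1 w0] le_geometric_mean[of m w2 w0]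
    by (auto simp: r pos_divide_le_eq)
  have "fourth_root w0 * \<bar>Q_integrand \<mu> g h l w0 (w1, w2)\<bar> = m / r0 * \<bar>x\<bar>"
    unfolding r(1) fourth_root_mult_coll_weight[symmetric] Q_integrand_def x_def
    by (simp add: Let_def n conservation[symmetric] mult.assoc)
  also have "\<dots> \<le> m / r0 * (n1 * n2 * a0 * b1 * c2 + n2 * n3 * (a1 * b2 * c3) + n1 * n3 * (a1 * b2 * c3)
         + n2 * n3 * a0 * b2 * c3 + n1 * n3 * a0 * b1 * c3)"
    using x_le rpos m by (intro mult_left_mono) auto
  also have "\<dots> = m / r0 * (n1 * n2 * a0 * b1 * c2) + m / r0 * (n2 * n3 * (a1 * b2 * c3)) +
      m / r0 * (n1 * n3 * (a1 * b2 * c3)) + m / r0 * (n2 * n3 * a0 * b2 * c3) + m / r0 * (n1 * n3 * a0 * b1 * c3)"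
    by (simp only: distrib_left)
  also have "\<dots> \<le> r0 * (n1 * n2 * a0 * b1 * c2) + r1 * (n2 * n3 * (a1 * b2 * c3)) +
      r2 * (n1 * n3 * (a1 * b2 * c3)) + r0 * (n2 * n3 * a0 * b2 * c3) + r0 * (n1 * n3 * a0 * b1 * c3)"
    using m_le nonneg by (intro add_mono mult_right_mono) simp_all
  also have "\<dots> = (\<Sum>t\<leftarrow>Q_terms \<mu> g h l. quad_product w0 w1 w2 w3 t)"
  proof -
    have "profile g w0 = r0 * a0" "profile g w1 = r1 * a1" "profile h w2 = r2 * b2"
      "smoothed \<mu> g w1 = n1 * a1" "smoothed \<mu> h w1 = n1 * b1" "smoothed \<mu> h w2 = n2 * b2"
      "smoothed \<mu> l w2 = n2 * c2" "smoothed \<mu> l w3 = n3 * c3"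
      using pos by (simp_all add: profile_def smoothed_def decay_def a b c n r)
    then show ?thesis
      by (simp add: Q_terms_def quad_product_def Let_def mult_ac)
  qed
  finally show ?thesis .
qed

end

section \<open>A Schur test for products over a collision\<close>

text \<open>Besides the $L^2$ bound the predicate records the trivial pointwise bound for bounded \<open>f\<close>. The first serves general elements of the Hilbert space, the second gives convergence at every point for test functions.\<close>

definition schur_bounded ::
  "(real \<Rightarrow> ennreal) \<Rightarrow> (real \<Rightarrow> ennreal) \<Rightarrow> (real \<Rightarrow> ennreal) \<Rightarrow> (real \<Rightarrow> ennreal) \<Rightarrow> bool" where
  "schur_bounded a b f T \<longleftrightarrow> T \<in> borel_measurable borel \<and>
     (\<integral>\<^sup>+z. (T z)\<^sup>2 \<partial>lborel) \<le>
       (\<integral>\<^sup>+x. a x \<partial>lborel)\<^sup>2 * (\<integral>\<^sup>+y. b y \<partial>lborel)\<^sup>2 * (\<integral>\<^sup>+z. (f z)\<^sup>2 \<partial>lborel) \<and>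
     (\<forall>c. (\<forall>x. f x \<le> c) \<longrightarrow> (\<forall>z. T z \<le> (\<integral>\<^sup>+x. a x \<partial>lborel) * (\<integral>\<^sup>+y. b y \<partial>lborel) * c))"

lemma nn_integral_lborel_prod:
  fixes F :: "real \<times> real \<Rightarrow> ennreal"
  assumes "F \<in> borel_measurable borel"
  shows "(\<integral>\<^sup>+p. F p \<partial>lborel) = (\<integral>\<^sup>+x. \<integral>\<^sup>+y. F (x, y) \<partial>lborel \<partial>lborel)"
  using lborel.nn_integral_fst[of F lborel] assms by (simp add: lborel_prod)

lemma nn_integral_translate:
  fixes f :: "real \<Rightarrow> ennreal"
  assumes "f \<in> borel_measurable borel"
  shows "(\<integral>\<^sup>+x. f (x + t) \<partial>lborel) = (\<integral>\<^sup>+x. f x \<partial>lborel)"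
  using nn_integral_real_affine[OF assms, of 1 t] by (simp add: add.commute)

lemma nn_integral_reflect:
  fixes f :: "real \<Rightarrow> ennreal"
  assumes "f \<in> borel_measurable borel"
  shows "(\<integral>\<^sup>+x. f (t - x) \<partial>lborel) = (\<integral>\<^sup>+x. f x \<partial>lborel)"
  using nn_integral_real_affine[OF assms, of "-1" t] by simp

lemma nn_integral_lborel_swap:
  fixes F :: "real \<Rightarrow> real \<Rightarrow> ennreal"
  assumes [measurable]: "(\<lambda>(x, y). F x y) \<in> borel_measurable (borel \<Otimes>\<^sub>M borel)"
  shows "(\<integral>\<^sup>+x. \<integral>\<^sup>+y. F x y \<partial>lborel \<partial>lborel) = (\<integral>\<^sup>+y. \<integral>\<^sup>+x. F x y \<partial>lborel \<partial>lborel)"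
  by (rule lborel_pair.Fubini'[symmetric]) simp

text \<open>Cauchy--Schwarz with respect to the measure $a(x)\,b(y)\,dx\,dy$ bounds the square of \<open>T z\<close> by the integral of the squares; Tonelli then integrates in \<open>z\<close> first, where the hypothesis on \<open>\<phi>\<close> says that the substitution preserves the $L^2$ norm of \<open>f\<close>.\<close>

lemma schur_bounded_integral:
  fixes a b f :: "real \<Rightarrow> ennreal" and \<phi> :: "real \<Rightarrow> real \<Rightarrow> real \<Rightarrow> real"
  assumes [measurable]: "a \<in> borel_measurable borel" "b \<in> borel_measurable borel"
      "f \<in> borel_measurable borel"
      "(\<lambda>p. \<phi> (fst p) (fst (snd p)) (snd (snd p))) \<in> borel_measurable (borel \<Otimes>\<^sub>M borel \<Otimes>\<^sub>M borel)"
    and phi: "\<And>x y. (\<integral>\<^sup>+z. (f (\<phi> x y z))\<^sup>2 \<partial>lborel) = (\<integral>\<^sup>+z. (f z)\<^sup>2 \<partial>lborel)"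
    and T: "\<And>z. T z = (\<integral>\<^sup>+x. \<integral>\<^sup>+y. a x * b y * f (\<phi> x y z) \<partial>lborel \<partial>lborel)"
  shows "schur_bounded a b f T"
proof -
  have [measurable]: "(\<lambda>w. \<phi> (u w) (v w) (t w)) \<in> borel_measurable M"
    if [measurable]: "u \<in> borel_measurable M" "v \<in> borel_measurable M" "t \<in> borel_measurable M" for u v t M
    using measurable_compose[of "\<lambda>w. (u w, v w, t w)" M "borel \<Otimes>\<^sub>M borel \<Otimes>\<^sub>M borel"
        "\<lambda>p. \<phi> (fst p) (fst (snd p)) (snd (snd p))" borel] by simp
  let ?A = "\<integral>\<^sup>+x. a x \<partial>lborel" and ?B = "\<integral>\<^sup>+y. b y \<partial>lborel"
  have T': "T = (\<lambda>z. \<integral>\<^sup>+x. \<integral>\<^sup>+y. a x * b y * f (\<phi> x y z) \<partial>lborel \<partial>lborel)"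
    using T by auto
  have meas [measurable]: "T \<in> borel_measurable borel"
    unfolding T' by measurable
  have AB: "(\<integral>\<^sup>+x. \<integral>\<^sup>+y. a x * b y * c \<partial>lborel \<partial>lborel) = ?A * ?B * c" for c
    by (simp add: nn_integral_cmult nn_integral_multc mult.assoc)
  have sq: "(T z)\<^sup>2 \<le> ?A * ?B * (\<integral>\<^sup>+x. \<integral>\<^sup>+y. a x * b y * (f (\<phi> x y z))\<^sup>2 \<partial>lborel \<partial>lborel)" for z
  proof -
    define M where "M = density (lborel \<Otimes>\<^sub>M lborel) (\<lambda>(x, y). a x * b y)"
    have M: "(\<integral>\<^sup>+p. F p \<partial>M) = (\<integral>\<^sup>+x. \<integral>\<^sup>+y. a x * b y * F (x, y) \<partial>lborel \<partial>lborel)"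
      if [measurable]: "F \<in> borel_measurable (borel \<Otimes>\<^sub>M borel)" for F
      unfolding M_def
      by (subst nn_integral_density)
         (auto simp: lborel.nn_integral_fst[symmetric] case_prod_beta intro!: nn_integral_cong)
    have "(\<integral>\<^sup>+p. 1 * f (\<phi> (fst p) (snd p) z) \<partial>M)\<^sup>2 \<le>
            (\<integral>\<^sup>+p. 1 ^ 2 \<partial>M) * (\<integral>\<^sup>+p. (f (\<phi> (fst p) (snd p) z))\<^sup>2 \<partial>M)"
      by (rule Cauchy_Schwarz_nn_integral) (simp_all add: M_def)
    moreover have "(\<integral>\<^sup>+p. 1 * f (\<phi> (fst p) (snd p) z) \<partial>M) = T z"
      by (subst M) (auto simp: T)
    moreover have "(\<integral>\<^sup>+p. 1 ^ 2 \<partial>M) = ?A * ?B"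
      using AB[of 1] by (subst M) auto
    moreover have "(\<integral>\<^sup>+p. (f (\<phi> (fst p) (snd p) z))\<^sup>2 \<partial>M) =
        (\<integral>\<^sup>+x. \<integral>\<^sup>+y. a x * b y * (f (\<phi> x y z))\<^sup>2 \<partial>lborel \<partial>lborel)"
      by (subst M) auto
    ultimately show ?thesis
      by simp
  qed
  have "(\<integral>\<^sup>+z. (T z)\<^sup>2 \<partial>lborel) \<le>
      (\<integral>\<^sup>+z. ?A * ?B * (\<integral>\<^sup>+x. \<integral>\<^sup>+y. a x * b y * (f (\<phi> x y z))\<^sup>2 \<partial>lborel \<partial>lborel) \<partial>lborel)"
    by (intro nn_integral_mono sq)
  also have "\<dots> = ?A * ?B * (\<integral>\<^sup>+z. \<integral>\<^sup>+x. \<integral>\<^sup>+y. a x * b y * (f (\<phi> x y z))\<^sup>2 \<partial>lborel \<partial>lborel \<partial>lborel)"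
    by (rule nn_integral_cmult) measurable
  also have "(\<integral>\<^sup>+z. \<integral>\<^sup>+x. \<integral>\<^sup>+y. a x * b y * (f (\<phi> x y z))\<^sup>2 \<partial>lborel \<partial>lborel \<partial>lborel) =
      (\<integral>\<^sup>+x. \<integral>\<^sup>+z. \<integral>\<^sup>+y. a x * b y * (f (\<phi> x y z))\<^sup>2 \<partial>lborel \<partial>lborel \<partial>lborel)"
    by (rule lborel_pair.Fubini') measurable
  also have "\<dots> = (\<integral>\<^sup>+x. \<integral>\<^sup>+y. \<integral>\<^sup>+z. a x * b y * (f (\<phi> x y z))\<^sup>2 \<partial>lborel \<partial>lborel \<partial>lborel)"
    by (intro nn_integral_cong lborel_pair.Fubini') measurable
  also have "\<dots> = (\<integral>\<^sup>+x. \<integral>\<^sup>+y. a x * b y * (\<integral>\<^sup>+z. (f z)\<^sup>2 \<partial>lborel) \<partial>lborel \<partial>lborel)"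
    by (intro nn_integral_cong) (simp add: nn_integral_cmult phi)
  also have "\<dots> = ?A * ?B * (\<integral>\<^sup>+z. (f z)\<^sup>2 \<partial>lborel)"
    by (rule AB)
  finally have "(\<integral>\<^sup>+z. (T z)\<^sup>2 \<partial>lborel) \<le> ?A\<^sup>2 * ?B\<^sup>2 * (\<integral>\<^sup>+z. (f z)\<^sup>2 \<partial>lborel)"
    by (simp add: power2_eq_square mult_ac)
  moreover have "T z \<le> ?A * ?B * c" if "\<And>x. f x \<le> c" for z c
    unfolding T AB[symmetric] by (intro nn_integral_mono mult_left_mono that) simp_all
  ultimately show ?thesis
    using meas by (auto simp: schur_bounded_def)
qed

text \<open>The integral runs over all \<open>x\<close> and \<open>y\<close>: as the factors are nonnegative, this only enlarges the integral over the collision domain.\<close>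

definition quad_integral ::
  "(real \<Rightarrow> ennreal) \<Rightarrow> (real \<Rightarrow> ennreal) \<Rightarrow> (real \<Rightarrow> ennreal) \<Rightarrow> (real \<Rightarrow> ennreal) \<Rightarrow> real \<Rightarrow> ennreal" where
  "quad_integral u0 u1 u2 u3 z = (\<integral>\<^sup>+x. \<integral>\<^sup>+y. u0 z * u1 x * u2 y * u3 (x + y - z) \<partial>lborel \<partial>lborel)"

context
  fixes u0 u1 u2 u3 :: "real \<Rightarrow> ennreal"
  assumes [measurable]: "u0 \<in> borel_measurable borel" "u1 \<in> borel_measurable borel"
    "u2 \<in> borel_measurable borel" "u3 \<in> borel_measurable borel"
begin

lemma quad_integral_swap: "quad_integral u0 u1 u2 u3 = quad_integral u0 u2 u1 u3"
  unfolding quad_integral_def fun_eq_iff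
  by (intro allI, subst nn_integral_lborel_swap) (simp_all add: mult_ac add.commute)

text \<open>The variables $(\omega_1, \omega_3)$ in place of $(\omega_1, \omega_2)$.\<close>

lemma quad_integral_shift:
  "quad_integral u0 u1 u2 u3 z = (\<integral>\<^sup>+x. \<integral>\<^sup>+y. u0 z * u1 x * u2 (y + z - x) * u3 y \<partial>lborel \<partial>lborel)"
  unfolding quad_integral_def
proof (rule nn_integral_cong)
  fix x
  show "(\<integral>\<^sup>+y. u0 z * u1 x * u2 y * u3 (x + y - z) \<partial>lborel) =
      (\<integral>\<^sup>+y. u0 z * u1 x * u2 (y + z - x) * u3 y \<partial>lborel)"
    using nn_integral_translate[of "\<lambda>y. u0 z * u1 x * u2 y * u3 (x + y - z)" "z - x"]
    by (simp add: algebra_simps)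
qed

end

text \<open>The two $L^1$ factors sit at two of the frequencies $\omega_1, \omega_2, \omega_3$, which serve as the integration variables. The factor \<open>f\<close> sits at $\omega_0$ or at the remaining frequency, which is then a translate or a reflection of $\omega_0$.\<close>

lemma schur_bounded_quad:
  fixes a b f :: "real \<Rightarrow> ennreal"
  assumes [measurable]: "a \<in> borel_measurable borel" "b \<in> borel_measurable borel"
      "f \<in> borel_measurable borel"
  shows "schur_bounded a b f (quad_integral f a b (\<lambda>_. 1))"
    and "schur_bounded a b f (quad_integral f a (\<lambda>_. 1) b)"
    and "schur_bounded a b f (quad_integral f (\<lambda>_. 1) a b)"
    and "schur_bounded a b f (quad_integral (\<lambda>_. 1) a b f)"
    and "schur_bounded a b f (quad_integral (\<lambda>_. 1) a f b)"
    and "schur_bounded a b f (quad_integral (\<lambda>_. 1) f a b)"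
proof -
  show "schur_bounded a b f (quad_integral f a b (\<lambda>_. 1))"
    by (rule schur_bounded_integral[where \<phi> = "\<lambda>_ _ z. z"])
       (auto simp: quad_integral_def mult_ac )
  show "schur_bounded a b f (quad_integral (\<lambda>_. 1) a b f)"
    by (rule schur_bounded_integral[where \<phi> = "\<lambda>x y z. x + y - z"])
       (auto simp: quad_integral_def mult_ac  nn_integral_reflect[where f = "\<lambda>z. (f z)\<^sup>2"])
  show *: "schur_bounded a b f (quad_integral f a (\<lambda>_. 1) b)"
    by (rule schur_bounded_integral[where \<phi> = "\<lambda>_ _ z. z"])
       (auto simp: quad_integral_shift mult_ac )
  show "schur_bounded a b f (quad_integral f (\<lambda>_. 1) a b)"
    using * by (subst quad_integral_swap) auto
  have tr: "(\<integral>\<^sup>+z. (f (y + z - x))\<^sup>2 \<partial>lborel) = (\<integral>\<^sup>+z. (f z)\<^sup>2 \<partial>lborel)" for x y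
    using nn_integral_translate[of "\<lambda>z. (f z)\<^sup>2" "y - x"] by (simp add: algebra_simps)
  show *: "schur_bounded a b f (quad_integral (\<lambda>_. 1) a f b)"
    by (rule schur_bounded_integral[where \<phi> = "\<lambda>x y z. y + z - x"])
       (auto simp: quad_integral_shift mult_ac  tr)
  show "schur_bounded a b f (quad_integral (\<lambda>_. 1) f a b)"
    using * by (subst quad_integral_swap) auto
qed

section \<open>Functions and classes in the weighted space\<close>

lemma nn_integral_weight_measure:
  fixes F :: "real \<Rightarrow> ennreal"
  assumes "F \<in> borel_measurable weight_measure"
  shows "(\<integral>\<^sup>+x. F x \<partial>weight_measure) = (\<integral>\<^sup>+x. ennreal (sqrt x) * F x * indicator {0<..} x \<partial>lborel)"
proof -
  have "F \<in> borel_measurable (restrict_space lborel {0<..})"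
    using assms by (simp add: weight_measure_def)
  then show ?thesis
    unfolding weight_measure_def
    by (subst nn_integral_density) (auto simp: nn_integral_restrict_space intro: measurable_restrict_space1)
qed

lemma space_weight_measure [simp]: "space weight_measure = {0<..}"
  by (simp add: weight_measure_def space_restrict_space)

lemma borel_imp_measurable_weight:
  "f \<in> borel_measurable borel \<Longrightarrow> f \<in> borel_measurable weight_measure"
  by (auto simp: weight_measure_def intro: measurable_restrict_space1)

lemma measurable_weight_imp_borel:
  fixes f :: "real \<Rightarrow> real"
  assumes "f \<in> borel_measurable weight_measure"
  shows "(\<lambda>x. if 0 < x then f x else 0) \<in> borel_measurable borel"
proof -
  have "f \<in> borel_measurable (restrict_space borel {0<..})"
    using assms by (simp add: weight_measure_def measurable_def space_restrict_space sets_restrict_space)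
  then have "(\<lambda>x. indicator {0<..} x *\<^sub>R f x) \<in> borel_measurable borel"
    by (subst (asm) borel_measurable_restrict_space_iff) auto
  also have "(\<lambda>x. indicator {0<..} x *\<^sub>R f x) = (\<lambda>x. if 0 < x then f x else 0)"
    by (auto simp: indicator_def)
  finally show ?thesis .
qed

text \<open>The squared norm, as an extended number: it is meaningful before integrability is known.\<close>

definition energy :: "(real \<Rightarrow> real) \<Rightarrow> ennreal" where
  "energy g = (\<integral>\<^sup>+x. ennreal ((g x)\<^sup>2) \<partial>weight_measure)"

lemma profile_measurable [measurable]:
  assumes "g \<in> borel_measurable weight_measure"
  shows "profile g \<in> borel_measurable borel"
proof -
  note [measurable] = measurable_weight_imp_borel[OF assms]
  have "profile g = (\<lambda>x. fourth_root x * \<bar>if 0 < x then g x else 0\<bar>)"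
    by (auto simp: profile_def)
  then show ?thesis by simp
qed

lemma energy_eq_profile:
  assumes [measurable]: "g \<in> borel_measurable weight_measure"
  shows "energy g = (\<integral>\<^sup>+x. (ennreal (profile g x))\<^sup>2 \<partial>lborel)"
  unfolding energy_def
  by (subst nn_integral_weight_measure)
     (auto intro!: nn_integral_cong
        simp: profile_def indicator_def ennreal_mult[symmetric] ennreal_power power_mult_distrib)

lemma square_integrable_iff:
  "f \<in> square_integrable \<longleftrightarrow> f \<in> borel_measurable weight_measure \<and> energy f < \<infinity>"
  unfolding square_integrable_def energy_def by (auto simp: integrable_iff_bounded)

lemma to_H_add:
  "f \<in> square_integrable \<Longrightarrow> g \<in> square_integrable \<Longrightarrow> to_H f + to_H g = to_H (\<lambda>x. f x + g x)"
  unfolding to_H_def by (rule plus_hspace.abs_eq) (auto simp: H_rel_def)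

lemma to_H_diff:
  "f \<in> square_integrable \<Longrightarrow> g \<in> square_integrable \<Longrightarrow> to_H f - to_H g = to_H (\<lambda>x. f x - g x)"
  unfolding to_H_def by (rule minus_hspace.abs_eq) (auto simp: H_rel_def)

lemma to_H_scaleR: "f \<in> square_integrable \<Longrightarrow> c *\<^sub>R to_H f = to_H (\<lambda>x. c * f x)"
  unfolding to_H_def by (rule scaleR_hspace.abs_eq) (auto simp: H_rel_def)

lemma to_H_eqI:
  assumes "f \<in> square_integrable" "g \<in> square_integrable" "AE x in weight_measure. f x = g x"
  shows "to_H f = to_H g"
  unfolding to_H_def using assms Quotient_rel_abs[OF Quotient_hspace, of f g] by (simp add: H_rel_def)

lemma norm_to_H_power2:
  assumes "f \<in> square_integrable"
  shows "ennreal ((norm (to_H f))\<^sup>2) = energy f"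
proof -
  have "(norm (to_H f))\<^sup>2 = inner (to_H f) (to_H f)"
    by (rule power2_norm_eq_inner)
  also have "\<dots> = integral\<^sup>L weight_measure (\<lambda>x. (f x)\<^sup>2)"
    unfolding to_H_def using assms by (subst inner_hspace.abs_eq) (auto simp: H_rel_def power2_eq_square)
  finally show ?thesis
    using assms unfolding energy_def by (subst nn_integral_eq_integral) (auto simp: square_integrable_def)
qed

lemma rep_hspace:
  shows "rep_hspace x \<in> square_integrable" and "to_H (rep_hspace x) = x"
  using Quotient_rep_reflp[OF Quotient_hspace, of x] Quotient_abs_rep[OF Quotient_hspace, of x]
  by (auto simp: H_rel_def to_H_def)

lemma hspace_representative:
  obtains f where "f \<in> square_integrable" "x = to_H f"
  using that rep_hspace by metis

section \<open>Integrals of the equilibrium\<close>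

text \<open>Separate power bounds near zero and near infinity suffice for integrability.\<close>

lemma nn_integral_powr_bound_finite:
  fixes f :: "real \<Rightarrow> real" and C a b :: real
  assumes "-1 < a" "b < -1" "\<And>x. x \<le> 0 \<Longrightarrow> f x \<le> 0"
    and "\<And>x. 0 < x \<Longrightarrow> x \<le> 1 \<Longrightarrow> f x \<le> C * x powr a" "\<And>x. 0 < x \<Longrightarrow> 1 \<le> x \<Longrightarrow> f x \<le> C * x powr b"
  shows "(\<integral>\<^sup>+x. ennreal (f x) \<partial>lborel) < \<infinity>"
proof -
  have I: "(\<integral>\<^sup>+x. ennreal (x powr a) * indicator {0..1} x \<partial>lborel) = ennreal (1 powr (a + 1) / (a + 1))"
    "(\<integral>\<^sup>+x. ennreal (x powr b) * indicator {1..} x \<partial>lborel) = ennreal (- (1 powr (b + 1)) / (b + 1))"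
    using assms(1,2)
    by (intro nn_integral_has_integral_lebesgue' has_integral_powr_from_0 has_integral_powr_to_inf; simp)+
  have "ennreal (f x) \<le> ennreal C * (ennreal (x powr a) * indicator {0..1} x) +
      ennreal C * (ennreal (x powr b) * indicator {1..} x)" for x
  proof (cases "x \<le> 0")
    case True
    then show ?thesis using assms(3)[of x] by (simp add: ennreal_neg)
  next
    case False
    have *: "ennreal (f x) \<le> ennreal C * ennreal p" if "f x \<le> C * p" "0 \<le> p" for p
      using that by (simp add: ennreal_leI flip: ennreal_mult'')
    show ?thesis
      using False *[OF assms(4)[of x]] *[OF assms(5)[of x]]
      by (cases "x \<le> 1") (auto simp: indicator_def intro: order_trans)
  qed
  then have "(\<integral>\<^sup>+x. ennreal (f x) \<partial>lborel) \<le> (\<integral>\<^sup>+x. ennreal C * (ennreal (x powr a) * indicator {0..1} x) +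
      ennreal C * (ennreal (x powr b) * indicator {1..} x) \<partial>lborel)"
    by (intro nn_integral_mono)
  also have "\<dots> < \<infinity>"
    by (subst nn_integral_add) (auto simp: nn_integral_cmult I ennreal_mult_less_top)
  finally show ?thesis .
qed

lemma fourth_root_eq_powr: "0 < x \<Longrightarrow> fourth_root x = x powr (1/4)"
  by (simp add: powr_half_sqrt[symmetric] powr_powr)

text \<open>The extension by zero makes the equilibrium a factor in integrals over the whole line.\<close>

definition equil_cut :: "real \<Rightarrow> real \<Rightarrow> real" where
  "equil_cut \<mu> x = (if 0 < x then equil \<mu> x else 0)"

text \<open>Near zero the equilibrium is bounded, near infinity it decays like $1/x$; so the integrand behaves like $x^{-s}$ and $x^{-k-s}$.\<close>

lemma equil_power_integral_finite:
  fixes \<mu> s :: real and k :: nat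
  assumes \<mu>: "0 < \<mu>" and s: "s < 1" "1 < k + s"
  shows "(\<integral>\<^sup>+x. ennreal (equil_cut \<mu> x ^ k * x powr (-s)) \<partial>lborel) < \<infinity>"
proof (rule nn_integral_powr_bound_finite[where C = "(1 + 1 / \<mu>) ^ k" and a = "-s" and b = "-(k + s)"])
  have C: "1 / \<mu> \<le> 1 + 1 / \<mu>" "1 \<le> 1 + 1 / \<mu>"
    using \<mu> by auto
  fix x :: real assume x: "0 < x"
  have "equil \<mu> x \<le> 1 / \<mu>" "equil \<mu> x \<le> 1 / x" "0 \<le> equil \<mu> x"
    using \<mu> x by (simp_all add: equil_def field_simps)
  moreover from this have "equil \<mu> x \<le> 1 + 1 / \<mu>"
    using C by linarith
  moreover have "1 / x \<le> (1 + 1 / \<mu>) * (1 / x)"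
    using x C(2) mult_right_mono[of 1 "1 + 1 / \<mu>" "1 / x"] by simp
  ultimately have *: "equil \<mu> x ^ k \<le> (1 + 1 / \<mu>) ^ k" "equil \<mu> x ^ k \<le> ((1 + 1 / \<mu>) * (1 / x)) ^ k"
    by (intro power_mono; linarith)+
  show "equil_cut \<mu> x ^ k * x powr (-s) \<le> (1 + 1 / \<mu>) ^ k * x powr (-s)"
    using x *(1) by (intro mult_right_mono) (auto simp: equil_cut_def)
  have "((1 + 1 / \<mu>) * (1 / x)) ^ k * x powr (-s) = (1 + 1 / \<mu>) ^ k * x powr (-(k + s))"
    using x by (simp add: power_mult_distrib powr_diff powr_minus powr_realpow power_divide divide_simps)
  then show "equil_cut \<mu> x ^ k * x powr (-s) \<le> (1 + 1 / \<mu>) ^ k * x powr (-(k + s))"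
    using x mult_right_mono[OF *(2), of "x powr (-s)"] by (simp add: equil_cut_def)
qed (use s in \<open>auto simp: equil_cut_def zero_power power_0_left\<close>)

definition decay_mass :: "real \<Rightarrow> ennreal" where
  "decay_mass \<mu> = (\<integral>\<^sup>+x. ennreal (decay \<mu> x) \<partial>lborel)"

definition decay_energy :: "real \<Rightarrow> ennreal" where
  "decay_energy \<mu> = (\<integral>\<^sup>+x. (ennreal (decay \<mu> x))\<^sup>2 \<partial>lborel)"

definition equil_energy :: "real \<Rightarrow> ennreal" where
  "equil_energy \<mu> = (\<integral>\<^sup>+x. (ennreal (equil_cut \<mu> x))\<^sup>2 \<partial>lborel)"

lemma equilibrium_integrals_finite:
  assumes "0 < \<mu>"
  shows "decay_mass \<mu> < \<infinity>" "decay_energy \<mu> < \<infinity>" "equil_energy \<mu> < \<infinity>"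
proof -
  have "decay \<mu> x = equil_cut \<mu> x ^ 1 * x powr (-1/4)" for x
    by (simp add: decay_def equil_cut_def fourth_root_eq_powr powr_minus divide_simps)
  then show "decay_mass \<mu> < \<infinity>"
    using equil_power_integral_finite[OF assms, of "1/4" 1] by (simp add: decay_mass_def)
  have "(decay \<mu> x)\<^sup>2 = equil_cut \<mu> x ^ 2 * x powr (-1/2)" for x
    by (simp add: decay_def equil_cut_def powr_half_sqrt powr_minus divide_simps)
  then show "decay_energy \<mu> < \<infinity>"
    using equil_power_integral_finite[OF assms, of "1/2" 2] assms
    by (simp add: decay_energy_def ennreal_power decay_def equil_def)
  have "(\<lambda>x. ennreal (equil_cut \<mu> x ^ 2 * x powr (-0))) = (\<lambda>x. (ennreal (equil_cut \<mu> x))\<^sup>2)"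
    using assms by (auto simp: fun_eq_iff equil_cut_def ennreal_power equil_def)
  then show "equil_energy \<mu> < \<infinity>"
    using equil_power_integral_finite[OF assms, of 0 2] by (simp add: equil_energy_def)
qed

lemma profile_nonneg: "0 \<le> profile g x"
  by (simp add: profile_def)

lemma equil_cut_nonneg: "0 < \<mu> \<Longrightarrow> 0 \<le> equil_cut \<mu> x"
  by (simp add: equil_cut_def equil_def)

lemma decay_nonneg: "0 < \<mu> \<Longrightarrow> 0 \<le> decay \<mu> x"
  by (simp add: decay_def equil_def)

lemma damped_eq: "damped \<mu> g x = equil_cut \<mu> x * profile g x"
  by (simp add: damped_def equil_cut_def profile_def)

lemma damped_nonneg: "0 < \<mu> \<Longrightarrow> 0 \<le> damped \<mu> g x"
  by (simp add: damped_eq profile_nonneg equil_cut_nonneg)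

lemma smoothed_nonneg: "0 < \<mu> \<Longrightarrow> 0 \<le> smoothed \<mu> g x"
  by (simp add: smoothed_def profile_nonneg decay_nonneg)

lemma equil_measurable [measurable]:
  "equil_cut \<mu> \<in> borel_measurable borel" "decay \<mu> \<in> borel_measurable borel"
  "equil \<mu> \<in> borel_measurable borel"
  unfolding equil_cut_def[abs_def] decay_def[abs_def] equil_def[abs_def] by measurable

lemma damped_measurable [measurable]:
  "g \<in> borel_measurable weight_measure \<Longrightarrow> damped \<mu> g \<in> borel_measurable borel"
  unfolding damped_eq[abs_def] by measurable

lemma smoothed_measurable [measurable]:
  "g \<in> borel_measurable weight_measure \<Longrightarrow> smoothed \<mu> g \<in> borel_measurable borel"
  unfolding smoothed_def[abs_def] by measurable

lemma damped_mass_le: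
  assumes "0 < \<mu>" and [measurable]: "g \<in> borel_measurable weight_measure"
  shows "(\<integral>\<^sup>+x. ennreal (damped \<mu> g x) \<partial>lborel)\<^sup>2 \<le> equil_energy \<mu> * energy g"
  unfolding equil_energy_def energy_eq_profile[OF assms(2)] damped_eq ennreal_mult[OF equil_cut_nonneg[OF assms(1)] profile_nonneg]
  by (rule Cauchy_Schwarz_nn_integral) measurable

lemma smoothed_mass_le:
  assumes "0 < \<mu>" and [measurable]: "g \<in> borel_measurable weight_measure"
  shows "(\<integral>\<^sup>+x. ennreal (smoothed \<mu> g x) \<partial>lborel)\<^sup>2 \<le> decay_energy \<mu> * energy g"
  unfolding decay_energy_def energy_eq_profile[OF assms(2)] smoothed_def ennreal_mult[OF decay_nonneg[OF assms(1)] profile_nonneg]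
  by (rule Cauchy_Schwarz_nn_integral) measurable

section \<open>Collision integrals of a general integrand\<close>

text \<open>Joint measurability is required only where the collision integral is evaluated, since integrands built from elements of the Hilbert space are unspecified at non-positive frequencies.\<close>

definition collision_measurable :: "(real \<Rightarrow> real \<times> real \<Rightarrow> real) \<Rightarrow> bool" where
  "collision_measurable I \<longleftrightarrow>
     (\<lambda>(w, p). indicator {0<..} w * (indicator (coll_domain w) p * I w p))
       \<in> borel_measurable (borel \<Otimes>\<^sub>M borel)"

definition coll_integral :: "(real \<Rightarrow> real \<times> real \<Rightarrow> real) \<Rightarrow> real \<Rightarrow> real" where
  "coll_integral I w = (LINT p:coll_domain w|lborel. I w p)"

text \<open>An extended number, so that convergence of the collision integral can be read off from its finiteness.\<close>

definition coll_abs_integral :: "(real \<Rightarrow> real \<times> real \<Rightarrow> real) \<Rightarrow> real \<Rightarrow> ennreal" where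
  "coll_abs_integral I w = (\<integral>\<^sup>+p. ennreal \<bar>indicator (coll_domain w) p * I w p\<bar> \<partial>lborel)"

definition coll_energy :: "(real \<Rightarrow> real \<times> real \<Rightarrow> real) \<Rightarrow> ennreal" where
  "coll_energy I = (\<integral>\<^sup>+w. (coll_abs_integral I w)\<^sup>2 \<partial>weight_measure)"

lemma collision_section_measurable:
  assumes "collision_measurable I" "0 < w"
  shows "(\<lambda>p. indicator (coll_domain w) p * I w p) \<in> borel_measurable borel"
  using measurable_Pair2[OF assms(1)[unfolded collision_measurable_def], of w] assms(2) by simp

lemma coll_abs_integral_measurable:
  assumes "collision_measurable I"
  shows "coll_abs_integral I \<in> borel_measurable weight_measure"
proof -
  note [measurable] = assms[unfolded collision_measurable_def]
  have "(\<lambda>w. \<integral>\<^sup>+p. ennreal \<bar>case (w, p) of (w, p) \<Rightarrow> indicator {0<..} w * (indicator (coll_domain w) p * I w p)\<bar> \<partial>lborel)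
      \<in> borel_measurable weight_measure" (is "?F \<in> _")
    by (rule borel_imp_measurable_weight) measurable
  moreover have "coll_abs_integral I w = ?F w" if "w \<in> space weight_measure" for w
    using that by (simp add: coll_abs_integral_def abs_mult)
  ultimately show ?thesis
    by (subst measurable_cong) 
qed

lemma set_integrable_if_coll_abs_integral_finite:
  assumes "collision_measurable I" "0 < w" "coll_abs_integral I w < \<infinity>"
  shows "set_integrable lborel (coll_domain w) (I w)"
  unfolding set_integrable_def integrable_iff_bounded
  using collision_section_measurable[OF assms(1,2)] assms(3) by (simp add: coll_abs_integral_def abs_mult)

text \<open>Where the integral diverges, the Bochner integral is zero by convention, so the bound holds there as well.\<close>

lemma coll_integral_le_coll_abs_integral: "ennreal \<bar>coll_integral I w\<bar> \<le> coll_abs_integral I w"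
proof (cases "set_integrable lborel (coll_domain w) (I w)")
  case True
  then show ?thesis
    using integral_norm_bound_ennreal[of lborel "\<lambda>p. indicator (coll_domain w) p *\<^sub>R I w p"]
    by (simp add: set_integrable_def coll_integral_def set_lebesgue_integral_def coll_abs_integral_def abs_mult)
next
  case False
  then show ?thesis
    by (simp add: coll_integral_def set_integrable_def set_lebesgue_integral_def not_integrable_integral_eq)
qed

lemma coll_integral_measurable:
  assumes "collision_measurable I"
  shows "coll_integral I \<in> borel_measurable weight_measure"
proof -
  note [measurable] = assms[unfolded collision_measurable_def]
  have "(\<lambda>w. \<integral>p. (case (w, p) of (w, p) \<Rightarrow> indicator {0<..} w * (indicator (coll_domain w) p * I w p)) \<partial>lborel)
      \<in> borel_measurable weight_measure" (is "?F \<in> _")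
    by (rule borel_imp_measurable_weight) measurable
  moreover have "coll_integral I w = ?F w" if "w \<in> space weight_measure" for w
    using that by (simp add: coll_integral_def set_lebesgue_integral_def)
  ultimately show ?thesis
    by (subst measurable_cong) 
qed

lemma energy_coll_integral_le: "energy (coll_integral I) \<le> coll_energy I"
  unfolding energy_def coll_energy_def
proof (rule nn_integral_mono)
  fix w
  have "ennreal ((coll_integral I w)\<^sup>2) = (ennreal \<bar>coll_integral I w\<bar>)\<^sup>2"
    by (simp add: ennreal_power)
  then show "ennreal ((coll_integral I w)\<^sup>2) \<le> (coll_abs_integral I w)\<^sup>2"
    using power_mono[OF coll_integral_le_coll_abs_integral[of I w], of 2] by simp
qed

lemma coll_integral_square_integrable:
  "collision_measurable I \<Longrightarrow> coll_energy I < \<infinity> \<Longrightarrow> coll_integral I \<in> square_integrable"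
  using energy_coll_integral_le[of I] coll_integral_measurable[of I]
  by (auto simp: square_integrable_iff intro: order.strict_trans1)

lemma AE_set_integrable:
  assumes "collision_measurable I" "coll_energy I < \<infinity>"
  shows "AE w in weight_measure. set_integrable lborel (coll_domain w) (I w)"
proof -
  have "AE w in weight_measure. (coll_abs_integral I w)\<^sup>2 \<noteq> \<infinity>"
    using assms coll_abs_integral_measurable[OF assms(1)]
    by (intro nn_integral_PInf_AE) (auto simp: coll_energy_def)
  then show ?thesis
    using AE_space
  proof eventually_elim
    case (elim w)
    then show ?case
      using set_integrable_if_coll_abs_integral_finite[OF assms(1), of w] by (auto simp: less_top power2_eq_square ennreal_mult_eq_top_iff)
  qed
qed

section \<open>Domination by products\<close>

definition quad_integrand :: "quad \<Rightarrow> real \<Rightarrow> real \<Rightarrow> real \<Rightarrow> ennreal" where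
  "quad_integrand = (\<lambda>(u0, u1, u2, u3) w x y. ennreal (u0 w) * ennreal (u1 x) * ennreal (u2 y) * ennreal (u3 (x + y - w)))"

definition quad_op :: "quad \<Rightarrow> real \<Rightarrow> ennreal" where
  "quad_op t w = (\<integral>\<^sup>+x. \<integral>\<^sup>+y. quad_integrand t w x y \<partial>lborel \<partial>lborel)"

lemma quad_op_eq:
  "quad_op (u0, u1, u2, u3) =
     quad_integral (\<lambda>x. ennreal (u0 x)) (\<lambda>x. ennreal (u1 x)) (\<lambda>x. ennreal (u2 x)) (\<lambda>x. ennreal (u3 x))"
  by (simp add: fun_eq_iff quad_op_def quad_integrand_def quad_integral_def)

text \<open>\<open>X\<close> bounds the square of the $L^2$ norm, and \<open>B\<close> stands for a condition under which the product integral converges at every point.\<close>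

definition quad_bounded :: "ennreal \<Rightarrow> bool \<Rightarrow> quad \<Rightarrow> bool" where
  "quad_bounded X B t \<longleftrightarrow>
     (case t of (u0, u1, u2, u3) \<Rightarrow>
        (\<forall>u\<in>{u0, u1, u2, u3}. u \<in> borel_measurable borel \<and> (\<forall>x. 0 \<le> u x))) \<and>
     quad_op t \<in> borel_measurable borel \<and> (\<integral>\<^sup>+w. (quad_op t w)\<^sup>2 \<partial>lborel) \<le> X \<and>
     (B \<longrightarrow> (\<forall>w. quad_op t w < \<infinity>))"

text \<open>Cauchy--Schwarz for the counting measure.\<close>

lemma sum_list_power2_le:
  fixes f :: "'a \<Rightarrow> ennreal"
  shows "(\<Sum>t\<leftarrow>ts. f t)\<^sup>2 \<le> of_nat (length ts) * (\<Sum>t\<leftarrow>ts. (f t)\<^sup>2)"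
proof -
  have "(\<Sum>i<length ts. 1 * f (ts ! i))\<^sup>2 \<le> (\<Sum>i<length ts. 1 ^ 2) * (\<Sum>i<length ts. (f (ts ! i))\<^sup>2)"
    using Cauchy_Schwarz_nn_integral[of "\<lambda>_. 1" "count_space {..<length ts}" "\<lambda>i. f (ts ! i)"]
    by (simp add: nn_integral_count_space_finite)
  then show ?thesis
    by (simp add: sum_list_sum_nth atLeast0LessThan)
qed

text \<open>The factor \<open>fourth_root w\<close> on the left is the one that turns the $L^2$ norm in \<open>w\<close> into the norm of the Hilbert space.\<close>

lemma coll_abs_integral_le_quad:
  assumes K: "0 \<le> K" and w: "0 < w" and coll: "collision_measurable I"
    and ts: "\<And>t. t \<in> set ts \<Longrightarrow> quad_bounded X B t"
    and le: "\<And>x y. 0 < x \<Longrightarrow> 0 < y \<Longrightarrow> w < x + y \<Longrightarrow>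
       fourth_root w * \<bar>I w (x, y)\<bar> \<le> K * (\<Sum>t\<leftarrow>ts. quad_product w x y (x + y - w) t)"
  shows "ennreal (fourth_root w) * coll_abs_integral I w \<le> ennreal K * (\<Sum>t\<leftarrow>ts. quad_op t w)"
proof -
  note [measurable] = collision_section_measurable[OF coll w]
  have meas [measurable]: "(\<lambda>(x, y). quad_integrand t w x y) \<in> borel_measurable (borel \<Otimes>\<^sub>M borel)"
    if "t \<in> set ts" for t
  proof -
    obtain u0 u1 u2 u3 where t: "t = (u0, u1, u2, u3)" by (cases t)
    have [measurable]: "u1 \<in> borel_measurable borel" "u2 \<in> borel_measurable borel" "u3 \<in> borel_measurable borel"
      using ts[OF that] by (auto simp: quad_bounded_def t)
    show ?thesis
      by (simp add: quad_integrand_def t)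
  qed
  have pointwise: "ennreal (fourth_root w * (indicator (coll_domain w) (x, y) * \<bar>I w (x, y)\<bar>)) \<le>
      ennreal K * (\<Sum>t\<leftarrow>ts. quad_integrand t w x y)" for x y
  proof (cases "(x, y) \<in> coll_domain w")
    case True
    have nonneg: "0 \<le> quad_product w x y (x + y - w) t" if "t \<in> set ts" for t
      using ts[OF that] by (auto simp: quad_bounded_def quad_product_def split: prod.splits)
    have eq: "ennreal (quad_product w x y (x + y - w) t) = quad_integrand t w x y" if "t \<in> set ts" for t
      using ts[OF that]
      by (auto simp: quad_bounded_def quad_product_def quad_integrand_def ennreal_mult split: prod.splits)
    have "set ss \<subseteq> set ts \<Longrightarrow>
      ennreal (\<Sum>t\<leftarrow>ss. quad_product w x y (x + y - w) t) = (\<Sum>t\<leftarrow>ss. quad_integrand t w x y) \<and>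
        0 \<le> (\<Sum>t\<leftarrow>ss. quad_product w x y (x + y - w) t)" for ss
      by (induction ss) (simp_all add: nonneg eq ennreal_plus)
    from this[of ts] have "ennreal K * (\<Sum>t\<leftarrow>ts. quad_integrand t w x y) =
        ennreal (K * (\<Sum>t\<leftarrow>ts. quad_product w x y (x + y - w) t))"
      using K by (simp add: ennreal_mult)
    then show ?thesis
      using True le[of x y] by (auto simp: coll_domain_def intro!: ennreal_leI)
  qed (simp add: indicator_def)
  have "ennreal (fourth_root w) * coll_abs_integral I w =
      (\<integral>\<^sup>+p. ennreal (fourth_root w) * ennreal \<bar>indicator (coll_domain w) p * I w p\<bar> \<partial>lborel)"
    by (subst nn_integral_cmult) (auto simp: coll_abs_integral_def)
  also have "\<dots> = (\<integral>\<^sup>+x. \<integral>\<^sup>+y. ennreal (fourth_root w) * ennreal \<bar>indicator (coll_domain w) (x, y) * I w (x, y)\<bar> \<partial>lborel \<partial>lborel)"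
    by (rule nn_integral_lborel_prod) measurable
  also have "\<dots> \<le> (\<integral>\<^sup>+x. \<integral>\<^sup>+y. ennreal K * (\<Sum>t\<leftarrow>ts. quad_integrand t w x y) \<partial>lborel \<partial>lborel)"
    using pointwise w by (intro nn_integral_mono) (simp add: abs_mult ennreal_mult)
  also have "\<dots> = (\<integral>\<^sup>+x. \<integral>\<^sup>+y. ennreal K * (\<Sum>i<length ts. quad_integrand (ts ! i) w x y) \<partial>lborel \<partial>lborel)"
    by (simp add: sum_list_sum_nth atLeast0LessThan)
  also have "\<dots> = ennreal K * (\<Sum>i<length ts. quad_op (ts ! i) w)"
  proof -
    have [measurable]: "(\<lambda>(x, y). quad_integrand (ts ! i) w x y) \<in> borel_measurable (borel \<Otimes>\<^sub>M borel)"
      if "i \<in> {..<length ts}" for i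
      using that by (intro meas) auto
    have "(\<integral>\<^sup>+x. \<integral>\<^sup>+y. ennreal K * (\<Sum>i<length ts. quad_integrand (ts ! i) w x y) \<partial>lborel \<partial>lborel) =
        (\<integral>\<^sup>+x. ennreal K * (\<Sum>i<length ts. \<integral>\<^sup>+y. quad_integrand (ts ! i) w x y \<partial>lborel) \<partial>lborel)"
      by (intro nn_integral_cong, subst nn_integral_cmult)
         (auto simp: nn_integral_sum intro!: borel_measurable_sum)
    also have "\<dots> = ennreal K * (\<Sum>i<length ts. \<integral>\<^sup>+x. \<integral>\<^sup>+y. quad_integrand (ts ! i) w x y \<partial>lborel \<partial>lborel)"
      by (subst nn_integral_cmult) (auto simp: nn_integral_sum intro!: borel_measurable_sum)
    finally show ?thesis
      by (simp add: quad_op_def)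
  qed
  also have "(\<Sum>i<length ts. quad_op (ts ! i) w) = (\<Sum>t\<leftarrow>ts. quad_op t w)"
    by (simp add: sum_list_sum_nth atLeast0LessThan)
  finally show ?thesis .
qed

lemma coll_abs_integral_finite_quad:
  assumes "0 \<le> K" "0 < w" "collision_measurable I"
    and ts: "\<And>t. t \<in> set ts \<Longrightarrow> quad_bounded X B t"
    and "\<And>x y. 0 < x \<Longrightarrow> 0 < y \<Longrightarrow> w < x + y \<Longrightarrow>
       fourth_root w * \<bar>I w (x, y)\<bar> \<le> K * (\<Sum>t\<leftarrow>ts. quad_product w x y (x + y - w) t)"
    and B
  shows "coll_abs_integral I w < \<infinity>"
proof -
  have "(\<Sum>t\<leftarrow>ss. quad_op t w) < \<infinity>" if "set ss \<subseteq> set ts" for ss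
    using that ts \<open>B\<close> by (induction ss) (auto simp: quad_bounded_def)
  from this[of ts] have "ennreal (fourth_root w) * coll_abs_integral I w < \<infinity>"
    by (intro order.strict_trans1[OF coll_abs_integral_le_quad[OF assms(1-5)]]) (auto simp: ennreal_mult_less_top)
  then show ?thesis
    using assms(2) by (auto simp: ennreal_mult_less_top)
qed

lemma coll_energy_le_quad:
  assumes K: "0 \<le> K" and coll: "collision_measurable I"
    and ts: "\<And>t. t \<in> set ts \<Longrightarrow> quad_bounded X B t"
    and le: "\<And>w x y. 0 < w \<Longrightarrow> 0 < x \<Longrightarrow> 0 < y \<Longrightarrow> w < x + y \<Longrightarrow>
       fourth_root w * \<bar>I w (x, y)\<bar> \<le> K * (\<Sum>t\<leftarrow>ts. quad_product w x y (x + y - w) t)"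
  shows "coll_energy I \<le> (ennreal K)\<^sup>2 * (of_nat (length ts))\<^sup>2 * X"
proof -
  have [measurable]: "quad_op (ts ! i) \<in> borel_measurable borel" if "i \<in> {..<length ts}" for i
    using ts[of "ts ! i"] that by (auto simp: quad_bounded_def)
  have "coll_energy I = (\<integral>\<^sup>+w. ennreal (sqrt w) * (coll_abs_integral I w)\<^sup>2 * indicator {0<..} w \<partial>lborel)"
    unfolding coll_energy_def using coll_abs_integral_measurable[OF coll] by (subst nn_integral_weight_measure) auto
  also have "\<dots> \<le> (\<integral>\<^sup>+w. (ennreal K)\<^sup>2 * (of_nat (length ts) * (\<Sum>i<length ts. (quad_op (ts ! i) w)\<^sup>2)) \<partial>lborel)"
  proof (rule nn_integral_mono)
    fix w
    show "ennreal (sqrt w) * (coll_abs_integral I w)\<^sup>2 * indicator {0<..} w \<le>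
        (ennreal K)\<^sup>2 * (of_nat (length ts) * (\<Sum>i<length ts. (quad_op (ts ! i) w)\<^sup>2))"
    proof (cases "0 < w")
      case True
      have "ennreal (sqrt w) * (coll_abs_integral I w)\<^sup>2 = (ennreal (fourth_root w) * coll_abs_integral I w)\<^sup>2"
        using True by (simp add: power_mult_distrib ennreal_power)
      also have "\<dots> \<le> (ennreal K * (\<Sum>t\<leftarrow>ts. quad_op t w))\<^sup>2"
        by (intro power_mono coll_abs_integral_le_quad[OF K True coll ts] le True) auto
      also have "\<dots> \<le> (ennreal K)\<^sup>2 * (of_nat (length ts) * (\<Sum>t\<leftarrow>ts. (quad_op t w)\<^sup>2))"
        unfolding power_mult_distrib by (intro mult_left_mono sum_list_power2_le) simp
      finally show ?thesis
        using True by (simp add: sum_list_sum_nth atLeast0LessThan)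
    qed simp
  qed
  also have "\<dots> = (ennreal K)\<^sup>2 * (of_nat (length ts) * (\<Sum>i<length ts. \<integral>\<^sup>+w. (quad_op (ts ! i) w)\<^sup>2 \<partial>lborel))"
    by (simp add: nn_integral_cmult nn_integral_sum)
  also have "\<dots> \<le> (ennreal K)\<^sup>2 * (of_nat (length ts) * (\<Sum>i<length ts. X))"
    using ts by (intro mult_left_mono sum_mono) (auto simp: quad_bounded_def)
  finally show ?thesis
    by (simp add: power2_eq_square mult_ac)
qed

section \<open>Energy bounds for the two collision operators\<close>

text \<open>All positions of two $L^1$ factors and one $L^2$ factor that are covered by \<open>schur_bounded_quad\<close>. Exchanging \<open>a\<close> and \<open>b\<close> gives the remaining ones.\<close>

definition placements :: "(real \<Rightarrow> real) \<Rightarrow> (real \<Rightarrow> real) \<Rightarrow> (real \<Rightarrow> real) \<Rightarrow> quad set" where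
  "placements a b f = (let e = (\<lambda>_. 1) in
     {(f, a, b, e), (f, a, e, b), (f, e, a, b), (e, a, b, f), (e, a, f, b), (e, f, a, b)})"

lemma quad_bounded_placements:
  assumes t: "t \<in> placements a b f \<union> placements b a f"
    and meas: "a \<in> borel_measurable borel" "b \<in> borel_measurable borel" "f \<in> borel_measurable borel"
    and nonneg: "\<And>x. 0 \<le> a x" "\<And>x. 0 \<le> b x" "\<And>x. 0 \<le> f x"
    and X: "(\<integral>\<^sup>+x. ennreal (a x) \<partial>lborel)\<^sup>2 * (\<integral>\<^sup>+x. ennreal (b x) \<partial>lborel)\<^sup>2 *
       (\<integral>\<^sup>+x. (ennreal (f x))\<^sup>2 \<partial>lborel) \<le> X"
    and fin: "(\<integral>\<^sup>+x. ennreal (a x) \<partial>lborel) < \<infinity>" "(\<integral>\<^sup>+x. ennreal (b x) \<partial>lborel) < \<infinity>"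
    and B: "B \<Longrightarrow> \<exists>c. \<forall>x. f x \<le> c"
  shows "quad_bounded X B t"
proof -
  have schur: "schur_bounded (\<lambda>x. ennreal (a x)) (\<lambda>x. ennreal (b x)) (\<lambda>x. ennreal (f x)) (quad_op t)"
    if "t \<in> placements a b f" "a \<in> borel_measurable borel" "b \<in> borel_measurable borel" for a b
    using that schur_bounded_quad[of "\<lambda>x. ennreal (a x)" "\<lambda>x. ennreal (b x)" "\<lambda>x. ennreal (f x)"] meas(3)
    by (auto simp: placements_def quad_op_eq Let_def)
  have schur: "schur_bounded (\<lambda>x. ennreal (a x)) (\<lambda>x. ennreal (b x)) (\<lambda>x. ennreal (f x)) (quad_op t)"
    using t schur[of a b] schur[of b a] meas by (auto simp: schur_bounded_def mult_ac)
  have "quad_op t w < \<infinity>" if B for w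
  proof -
    obtain c where "\<And>x. f x \<le> c" using B \<open>B\<close> by auto
    then have "quad_op t w \<le> (\<integral>\<^sup>+x. ennreal (a x) \<partial>lborel) * (\<integral>\<^sup>+x. ennreal (b x) \<partial>lborel) * ennreal c"
      using schur unfolding schur_bounded_def by (auto intro: ennreal_leI)
    also have "\<dots> < \<infinity>"
      using fin by (auto simp: ennreal_mult_less_top)
    finally show ?thesis .
  qed
  then show ?thesis
    using t meas nonneg schur X by (auto simp: quad_bounded_def placements_def Let_def schur_bounded_def)
qed

lemma mass_finite:
  assumes "0 < \<mu>" "g \<in> square_integrable"
  shows "(\<integral>\<^sup>+x. ennreal (damped \<mu> g x) \<partial>lborel) < \<infinity>" "(\<integral>\<^sup>+x. ennreal (smoothed \<mu> g x) \<partial>lborel) < \<infinity>"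
proof -
  have "equil_energy \<mu> * energy g < \<infinity>" "decay_energy \<mu> * energy g < \<infinity>"
    using assms equilibrium_integrals_finite[OF assms(1)]
    by (auto simp: square_integrable_iff ennreal_mult_less_top)
  then have "(\<integral>\<^sup>+x. ennreal (damped \<mu> g x) \<partial>lborel)\<^sup>2 < \<infinity>" "(\<integral>\<^sup>+x. ennreal (smoothed \<mu> g x) \<partial>lborel)\<^sup>2 < \<infinity>"
    using damped_mass_le[of \<mu> g] smoothed_mass_le[of \<mu> g] assms
    by (auto simp: square_integrable_iff intro: order.strict_trans1)
  then show "(\<integral>\<^sup>+x. ennreal (damped \<mu> g x) \<partial>lborel) < \<infinity>" "(\<integral>\<^sup>+x. ennreal (smoothed \<mu> g x) \<partial>lborel) < \<infinity>"
    by (simp_all add: power_less_top_ennreal)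
qed

definition profile_bounded :: "(real \<Rightarrow> real) \<Rightarrow> bool" where
  "profile_bounded g \<longleftrightarrow> (\<exists>c. \<forall>x. profile g x \<le> c)"

lemma Gamma_terms_bounded:
  assumes mu: "0 < \<mu>" and g: "g \<in> square_integrable" and h: "h \<in> square_integrable"
    and t: "t \<in> set (Gamma_terms \<mu> g h)"
  shows "quad_bounded ((decay_mass \<mu>)\<^sup>2 * equil_energy \<mu> * (energy g * energy h))
    (profile_bounded g \<and> profile_bounded h) t"
proof -
  have [measurable]: "g \<in> borel_measurable weight_measure" "h \<in> borel_measurable weight_measure"
    using g h by (auto simp: square_integrable_iff)
  let ?X = "(decay_mass \<mu>)\<^sup>2 * equil_energy \<mu> * (energy g * energy h)"
  let ?B = "profile_bounded g \<and> profile_bounded h"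
  have X: "(\<integral>\<^sup>+x. ennreal (decay \<mu> x) \<partial>lborel)\<^sup>2 * (\<integral>\<^sup>+x. ennreal (damped \<mu> u x) \<partial>lborel)\<^sup>2 *
       (\<integral>\<^sup>+x. (ennreal (profile v x))\<^sup>2 \<partial>lborel) \<le> ?X"
    if "(u = g \<and> v = h) \<or> (u = h \<and> v = g)" for u v
  proof -
    have uv: "u \<in> borel_measurable weight_measure" "v \<in> borel_measurable weight_measure"
      and eq: "energy g * energy h = energy u * energy v"
      using that by (auto simp: mult.commute)
    have "(decay_mass \<mu>)\<^sup>2 * (\<integral>\<^sup>+x. ennreal (damped \<mu> u x) \<partial>lborel)\<^sup>2 * energy v \<le>
        (decay_mass \<mu>)\<^sup>2 * (equil_energy \<mu> * energy u) * energy v"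
      by (intro mult_left_mono mult_right_mono damped_mass_le[OF mu uv(1)]) auto
    then show ?thesis
      unfolding eq energy_eq_profile[OF uv(2), symmetric] decay_mass_def[symmetric]
      by (simp add: mult_ac)
  qed
  have D: "quad_bounded ?X ?B t"
    if "t \<in> placements (decay \<mu>) (damped \<mu> u) (profile v) \<union> placements (damped \<mu> u) (decay \<mu>) (profile v)"
      "(u = g \<and> v = h) \<or> (u = h \<and> v = g)" for u v
  proof (rule quad_bounded_placements[OF that(1) _ _ _ _ _ _ X[OF that(2)]])
    show "damped \<mu> u \<in> borel_measurable borel" "profile v \<in> borel_measurable borel"
      "(\<integral>\<^sup>+x. ennreal (damped \<mu> u x) \<partial>lborel) < \<infinity>" "?B \<Longrightarrow> \<exists>c. \<forall>x. profile v x \<le> c"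
      using that(2) g h mass_finite(1)[OF mu] by (auto simp: profile_bounded_def)
  qed (use mu equilibrium_integrals_finite(1)[OF mu] in
      \<open>auto simp: decay_mass_def profile_nonneg damped_nonneg decay_nonneg\<close>)
  have "t \<in> placements (decay \<mu>) (damped \<mu> h) (profile g) \<union> placements (damped \<mu> h) (decay \<mu>) (profile g) \<or>
      t \<in> placements (decay \<mu>) (damped \<mu> g) (profile h) \<union> placements (damped \<mu> g) (decay \<mu>) (profile h)"
    using t unfolding Gamma_terms_def placements_def Let_def list.set by (elim insertE emptyE; simp)
  then show ?thesis
    using D by auto
qed

lemma Q_terms_bounded:
  assumes mu: "0 < \<mu>" and g: "g \<in> square_integrable" and h: "h \<in> square_integrable" and l: "l \<in> square_integrable"
    and t: "t \<in> set (Q_terms \<mu> g h l)"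
  shows "quad_bounded ((decay_energy \<mu>)\<^sup>2 * (energy g * energy h * energy l))
    (profile_bounded g \<and> profile_bounded h \<and> profile_bounded l) t"
proof -
  let ?X = "(decay_energy \<mu>)\<^sup>2 * (energy g * energy h * energy l)"
  let ?B = "profile_bounded g \<and> profile_bounded h \<and> profile_bounded l"
  have D: "quad_bounded ?X ?B t"
    if t: "t \<in> placements (smoothed \<mu> u) (smoothed \<mu> v) (profile f) \<union> placements (smoothed \<mu> v) (smoothed \<mu> u) (profile f)"
      and uvf: "{u, v, f} \<subseteq> {g, h, l}" and eq: "energy g * energy h * energy l = energy u * energy v * energy f"
    for u v f
  proof -
    have sq: "u \<in> square_integrable" "v \<in> square_integrable" "f \<in> square_integrable"
      using uvf g h l by auto
    then have meas [measurable]: "u \<in> borel_measurable weight_measure" "v \<in> borel_measurable weight_measure"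
      "f \<in> borel_measurable weight_measure"
      by (auto simp: square_integrable_iff)
    have "(\<integral>\<^sup>+x. ennreal (smoothed \<mu> u x) \<partial>lborel)\<^sup>2 * (\<integral>\<^sup>+x. ennreal (smoothed \<mu> v x) \<partial>lborel)\<^sup>2 * energy f \<le>
        (decay_energy \<mu> * energy u) * (decay_energy \<mu> * energy v) * energy f"
      by (intro mult_mono smoothed_mass_le[OF mu] meas) auto
    then have X: "(\<integral>\<^sup>+x. ennreal (smoothed \<mu> u x) \<partial>lborel)\<^sup>2 * (\<integral>\<^sup>+x. ennreal (smoothed \<mu> v x) \<partial>lborel)\<^sup>2 *
       (\<integral>\<^sup>+x. (ennreal (profile f x))\<^sup>2 \<partial>lborel) \<le> ?X"
      unfolding eq energy_eq_profile[OF meas(3), symmetric] by (simp add: mult_ac power2_eq_square)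
    show ?thesis
    proof (rule quad_bounded_placements[OF t _ _ _ _ _ _ X])
      show "?B \<Longrightarrow> \<exists>c. \<forall>x. profile f x \<le> c"
        using uvf by (auto simp: profile_bounded_def)
    qed (use sq mass_finite(2)[OF mu] in \<open>auto simp: profile_nonneg smoothed_nonneg[OF mu]\<close>)
  qed
  have "t \<in> placements (smoothed \<mu> h) (smoothed \<mu> l) (profile g) \<or>
      t \<in> placements (smoothed \<mu> g) (smoothed \<mu> l) (profile h)"
    using t unfolding Q_terms_def placements_def Let_def list.set by (elim insertE emptyE; simp)
  then show ?thesis
    using D[of h l g] D[of g l h] by (auto simp: mult_ac)
qed

text \<open>In this form measurability is automatic, unlike for the minimum of a set.\<close>

lemma coll_weight_eq:
  "coll_weight w0 w1 w2 w3 = min (sqrt w0) (min (sqrt w1) (min (sqrt w2) (sqrt w3))) / sqrt w0"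
  by (simp add: coll_weight_def)

text \<open>An integrand may be replaced by a Borel one that agrees with it on the collision domain, in particular by the one built from functions cut off at zero.\<close>

lemma collision_measurable_cong:
  assumes "\<And>w x y. 0 < w \<Longrightarrow> 0 < x \<Longrightarrow> 0 < y \<Longrightarrow> w < x + y \<Longrightarrow> I w (x, y) = J w (x, y)"
    and [measurable]: "(\<lambda>(w, p). J w p) \<in> borel_measurable (borel \<Otimes>\<^sub>M borel)"
  shows "collision_measurable I"
proof -
  have [measurable]: "(\<lambda>(w, p). J w p) \<in> borel_measurable (borel \<Otimes>\<^sub>M (borel \<Otimes>\<^sub>M borel))"
    using assms(2) by (simp add: borel_prod)
  have "(\<lambda>(w, p). indicator {0<..} w * (indicator (coll_domain w) p * I w p)) =
     (\<lambda>(w, p). if 0 < w \<and> 0 < fst p \<and> 0 < snd p \<and> w < fst p + snd p then J w p else 0)"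
    using assms(1) by (auto simp: fun_eq_iff coll_domain_def indicator_def)
  also have "\<dots> \<in> borel_measurable (borel \<Otimes>\<^sub>M (borel \<Otimes>\<^sub>M borel))"
    by measurable
  finally show ?thesis
    by (simp add: collision_measurable_def borel_prod)
qed

lemma Gamma_integrand_measurable:
  assumes "g \<in> square_integrable" "h \<in> square_integrable"
  shows "collision_measurable (Gamma_integrand \<mu> g h)"
proof -
  define g' h' where "g' = (\<lambda>x. if 0 < x then g x else 0)" and "h' = (\<lambda>x. if 0 < x then h x else 0)"
  have [measurable]: "g' \<in> borel_measurable borel" "h' \<in> borel_measurable borel"
    using assms unfolding g'_def h'_def by (auto intro!: measurable_weight_imp_borel simp: square_integrable_iff)
  show ?thesis
  proof (rule collision_measurable_cong)
    show "(\<lambda>(w, p). Gamma_integrand \<mu> g' h' w p) \<in> borel_measurable (borel \<Otimes>\<^sub>M borel)"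
      unfolding Gamma_integrand_def coll_weight_eq Let_def borel_prod[symmetric] by measurable
  qed (simp add: Gamma_integrand_def g'_def h'_def)
qed

lemma Q_integrand_measurable:
  assumes "g \<in> square_integrable" "h \<in> square_integrable" "l \<in> square_integrable"
  shows "collision_measurable (Q_integrand \<mu> g h l)"
proof -
  define g' h' l' where "g' = (\<lambda>x. if 0 < x then g x else 0)" and "h' = (\<lambda>x. if 0 < x then h x else 0)"
    and "l' = (\<lambda>x. if 0 < x then l x else 0)"
  have [measurable]: "g' \<in> borel_measurable borel" "h' \<in> borel_measurable borel" "l' \<in> borel_measurable borel"
    using assms unfolding g'_def h'_def l'_def by (auto intro!: measurable_weight_imp_borel simp: square_integrable_iff)
  show ?thesis
  proof (rule collision_measurable_cong)
    show "(\<lambda>(w, p). Q_integrand \<mu> g' h' l' w p) \<in> borel_measurable (borel \<Otimes>\<^sub>M borel)"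
      unfolding Q_integrand_def coll_weight_eq Let_def borel_prod[symmetric] by measurable
  qed (simp add: Q_integrand_def g'_def h'_def l'_def)
qed

text \<open>The factor $2$ of \<open>Gamma_integrand_le\<close> and the number of products, $12$ for $\Gamma$ and $5$ for $Q$, enter squared.\<close>

definition Gamma_const :: "real \<Rightarrow> ennreal" where
  "Gamma_const \<mu> = 4 * 144 * ((decay_mass \<mu>)\<^sup>2 * equil_energy \<mu>)"

definition Q_const :: "real \<Rightarrow> ennreal" where
  "Q_const \<mu> = 25 * (decay_energy \<mu>)\<^sup>2"

lemma const_finite:
  assumes "0 < \<mu>" shows "Gamma_const \<mu> < \<infinity>" "Q_const \<mu> < \<infinity>"
  using equilibrium_integrals_finite[OF assms]
  by (auto simp: Gamma_const_def Q_const_def ennreal_mult_less_top power2_eq_square)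

lemma Gamma_integrand_quad_le:
  assumes "0 < \<mu>" "0 < w" "0 < x" "0 < y" "w < x + y"
  shows "fourth_root w * \<bar>Gamma_integrand \<mu> g h w (x, y)\<bar> \<le>
     2 * (\<Sum>t\<leftarrow>Gamma_terms \<mu> g h. quad_product w x y (x + y - w) t)"
proof -
  interpret collision \<mu> w x y "x + y - w"
    using assms by unfold_locales auto
  show ?thesis by (rule Gamma_integrand_le)
qed

lemma Q_integrand_quad_le:
  assumes "0 < \<mu>" "0 < w" "0 < x" "0 < y" "w < x + y"
  shows "fourth_root w * \<bar>Q_integrand \<mu> g h l w (x, y)\<bar> \<le>
     1 * (\<Sum>t\<leftarrow>Q_terms \<mu> g h l. quad_product w x y (x + y - w) t)"
proof -
  interpret collision \<mu> w x y "x + y - w"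
    using assms by unfold_locales auto
  show ?thesis using Q_integrand_le by simp
qed

lemma Gamma_energy_le:
  assumes "0 < \<mu>" "g \<in> square_integrable" "h \<in> square_integrable"
  shows "coll_energy (Gamma_integrand \<mu> g h) \<le> Gamma_const \<mu> * (energy g * energy h)"
proof -
  have "coll_energy (Gamma_integrand \<mu> g h) \<le> (ennreal 2)\<^sup>2 * (of_nat (length (Gamma_terms \<mu> g h)))\<^sup>2 *
      ((decay_mass \<mu>)\<^sup>2 * equil_energy \<mu> * (energy g * energy h))"
    using assms by (intro coll_energy_le_quad[OF _ _ Gamma_terms_bounded] Gamma_integrand_measurable Gamma_integrand_quad_le) auto
  then show ?thesis
    by (simp add: Gamma_const_def Gamma_terms_def Let_def mult_ac ennreal_power)
qed

lemma Q_energy_le: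
  assumes "0 < \<mu>" "g \<in> square_integrable" "h \<in> square_integrable" "l \<in> square_integrable"
  shows "coll_energy (Q_integrand \<mu> g h l) \<le> Q_const \<mu> * (energy g * energy h * energy l)"
proof -
  have "coll_energy (Q_integrand \<mu> g h l) \<le> (ennreal 1)\<^sup>2 * (of_nat (length (Q_terms \<mu> g h l)))\<^sup>2 *
      ((decay_energy \<mu>)\<^sup>2 * (energy g * energy h * energy l))"
    using assms by (intro coll_energy_le_quad[OF _ _ Q_terms_bounded] Q_integrand_measurable Q_integrand_quad_le) auto
  then show ?thesis
    by (simp add: Q_const_def Q_terms_def Let_def mult_ac)
qed

text \<open>A continuous function on its compact support is bounded.\<close>

lemma test_function_profile_bounded:
  assumes "f \<in> test_functions"
  shows "profile_bounded f"
proof -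
  define K where "K = closure {x. f x \<noteq> 0}"
  have K: "compact K"
    using assms by (auto simp: test_functions_def K_def)
  have "f differentiable at x" for x
    using assms funpow_0[of deriv f] unfolding test_functions_def by (metis (mono_tags, lifting) mem_Collect_eq)
  then have "continuous_on K (\<lambda>x. fourth_root x * f x)"
    by (intro continuous_intros) (simp add: continuous_at_imp_continuous_on differentiable_imp_continuous_within)
  then have "bounded ((\<lambda>x. fourth_root x * f x) ` K)"
    using K compact_continuous_image compact_imp_bounded by blast
  then obtain c where c: "\<And>x. x \<in> K \<Longrightarrow> \<bar>fourth_root x * f x\<bar> \<le> c"
    by (auto simp: bounded_iff)
  have "profile f x \<le> max c 0" for x
  proof (cases "x \<in> K")
    case True
    then show ?thesis using c[of x] by (auto simp: profile_def abs_mult)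
  next
    case False
    then have "f x = 0"
      using closure_subset[of "{x. f x \<noteq> 0}"] by (auto simp: K_def)
    then show ?thesis by (simp add: profile_def)
  qed
  then show ?thesis
    by (auto simp: profile_bounded_def)
qed

lemma integrands_set_integrable:
  assumes mu: "0 < \<mu>" and w: "0 < w" and tests: "g \<in> test_functions" "h \<in> test_functions" "l \<in> test_functions"
  shows "set_integrable lborel (coll_domain w) (Gamma_integrand \<mu> g h w)"
    and "set_integrable lborel (coll_domain w) (Q_integrand \<mu> g h l w)"
proof -
  have sq: "g \<in> square_integrable" "h \<in> square_integrable" "l \<in> square_integrable"
    using tests test_functions_square_integrable by auto
  have bd: "profile_bounded g" "profile_bounded h" "profile_bounded l"
    using tests by (auto intro: test_function_profile_bounded)
  have "coll_abs_integral (Gamma_integrand \<mu> g h) w < \<infinity>"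
    by (rule coll_abs_integral_finite_quad[OF _ w Gamma_integrand_measurable[OF sq(1,2)]
          Gamma_terms_bounded[OF mu sq(1,2)] Gamma_integrand_quad_le[OF mu w]])
       (use bd in simp_all)
  then show "set_integrable lborel (coll_domain w) (Gamma_integrand \<mu> g h w)"
    by (intro set_integrable_if_coll_abs_integral_finite Gamma_integrand_measurable sq w)
  have "coll_abs_integral (Q_integrand \<mu> g h l) w < \<infinity>"
    by (rule coll_abs_integral_finite_quad[OF _ w Q_integrand_measurable[OF sq]
          Q_terms_bounded[OF mu sq] Q_integrand_quad_le[OF mu w]])
       (use bd in simp_all)
  then show "set_integrable lborel (coll_domain w) (Q_integrand \<mu> g h l w)"
    by (intro set_integrable_if_coll_abs_integral_finite Q_integrand_measurable sq w)
qed

section \<open>The operators on the Hilbert space\<close>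

text \<open>Additivity of the integral requires both summands to be integrable, which holds almost everywhere.\<close>

lemma coll_integral_add:
  assumes "collision_measurable I" "coll_energy I < \<infinity>" "collision_measurable J" "coll_energy J < \<infinity>"
    and sum: "coll_integral (\<lambda>w p. I w p + J w p) \<in> square_integrable"
  shows "to_H (coll_integral (\<lambda>w p. I w p + J w p)) = to_H (coll_integral I) + to_H (coll_integral J)"
proof -
  have sq: "coll_integral I \<in> square_integrable" "coll_integral J \<in> square_integrable"
    using assms by (auto intro: coll_integral_square_integrable)
  have "AE w in weight_measure. coll_integral (\<lambda>w p. I w p + J w p) w = coll_integral I w + coll_integral J w"
    using AE_set_integrable[OF assms(1,2)] AE_set_integrable[OF assms(3,4)]
    by eventually_elim (simp add: coll_integral_def set_integral_add)
  then show ?thesis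
    unfolding to_H_add[OF sq] by (intro to_H_eqI sum square_integrable_add sq)
qed

lemma coll_integral_scale: "coll_integral (\<lambda>w p. c * I w p) = (\<lambda>w. c * coll_integral I w)"
  by (simp add: coll_integral_def fun_eq_iff)

text \<open>One argument of a collision operator, with the other arguments fixed. A bound on absolute energies that is linear in \<open>energy g\<close> suffices to pass from functions to classes: functions that agree almost everywhere differ by a function of zero energy, whose image is zero. Applied to each argument in turn, this yields multilinear maps.\<close>

locale integrand_slot =
  fixes J :: "(real \<Rightarrow> real) \<Rightarrow> real \<Rightarrow> real \<times> real \<Rightarrow> real" and K :: ennreal
  assumes K: "K < \<infinity>"
    and measurable: "\<And>g. g \<in> square_integrable \<Longrightarrow> collision_measurable (J g)"
    and energy: "\<And>g. g \<in> square_integrable \<Longrightarrow> coll_energy (J g) \<le> K * energy g"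
    and add: "\<And>g h. J (\<lambda>x. g x + h x) = (\<lambda>w p. J g w p + J h w p)"
    and scale: "\<And>c g. J (\<lambda>x. c * g x) = (\<lambda>w p. c * J g w p)"
begin

definition slot_map :: "(real \<Rightarrow> real) \<Rightarrow> hspace" where
  "slot_map g = to_H (coll_integral (J g))"

lemma energy_finite: "g \<in> square_integrable \<Longrightarrow> coll_energy (J g) < \<infinity>"
  by (rule order.strict_trans1[OF energy])
     (use K in \<open>auto simp: square_integrable_iff ennreal_mult_less_top\<close>)

lemma formula_square_integrable:
  "g \<in> square_integrable \<Longrightarrow> coll_integral (J g) \<in> square_integrable"
  by (intro coll_integral_square_integrable measurable energy_finite)

lemma slot_map_add: "g \<in> square_integrable \<Longrightarrow> h \<in> square_integrable \<Longrightarrow> slot_map (\<lambda>x. g x + h x) = slot_map g + slot_map h"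
  unfolding slot_map_def add
  by (rule coll_integral_add)
     (use energy_finite in \<open>auto simp: measurable add[symmetric] formula_square_integrable square_integrable_add\<close>)

lemma slot_map_scale: "g \<in> square_integrable \<Longrightarrow> slot_map (\<lambda>x. c * g x) = c *\<^sub>R slot_map g"
  unfolding slot_map_def scale by (simp add: to_H_scaleR formula_square_integrable coll_integral_scale)

lemma slot_map_zero:
  assumes "g \<in> square_integrable" "to_H g = 0"
  shows "slot_map g = 0"
proof -
  have "ennreal ((norm (slot_map g))\<^sup>2) = energy (coll_integral (J g))"
    unfolding slot_map_def by (intro norm_to_H_power2 formula_square_integrable assms)
  also have "\<dots> \<le> K * energy g"
    using energy_coll_integral_le energy[OF assms(1)] by (rule order_trans)
  also have "energy g = 0"
    using norm_to_H_power2[OF assms(1)] assms(2) by simp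
  finally show ?thesis by simp
qed

lemma slot_map_cong:
  assumes "g \<in> square_integrable" "h \<in> square_integrable" "to_H g = to_H h"
  shows "slot_map g = slot_map h"
proof -
  have sq: "(\<lambda>x. g x - h x) \<in> square_integrable"
    by (intro square_integrable_diff assms)
  have "slot_map (\<lambda>x. (g x - h x) + h x) = slot_map (\<lambda>x. g x - h x) + slot_map h"
    by (rule slot_map_add[OF sq assms(2)])
  also have "slot_map (\<lambda>x. g x - h x) = 0"
    using assms by (intro slot_map_zero sq) (simp flip: to_H_diff)
  finally show ?thesis by simp
qed

lemma slot_map_rep_to_H: "g \<in> square_integrable \<Longrightarrow> slot_map (rep_hspace (to_H g)) = slot_map g"
  by (intro slot_map_cong rep_hspace) (simp_all add: rep_hspace)

lemma linear_slot_map: "linear (\<lambda>x. slot_map (rep_hspace x))"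
proof (rule linearI)
  show "slot_map (rep_hspace (x + y)) = slot_map (rep_hspace x) + slot_map (rep_hspace y)" for x y
  proof -
    have "slot_map (rep_hspace (x + y)) = slot_map (\<lambda>t. rep_hspace x t + rep_hspace y t)"
      by (intro slot_map_cong rep_hspace square_integrable_add) (simp add: to_H_add[symmetric] rep_hspace)
    then show ?thesis by (simp add: slot_map_add rep_hspace)
  qed
  show "slot_map (rep_hspace (c *\<^sub>R x)) = c *\<^sub>R slot_map (rep_hspace x)" for c x
  proof -
    have "slot_map (rep_hspace (c *\<^sub>R x)) = slot_map (\<lambda>t. c * rep_hspace x t)"
      by (intro slot_map_cong rep_hspace square_integrable_scale) (simp add: to_H_scaleR[symmetric] rep_hspace)
    then show ?thesis by (simp add: slot_map_scale rep_hspace)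
  qed
qed

end

lemma Gamma_formula_eq: "Gamma_formula \<mu> g h = coll_integral (Gamma_integrand \<mu> g h)"
  by (simp add: fun_eq_iff Gamma_formula_def coll_integral_def)

lemma Q_formula_eq: "Q_formula \<mu> g h l = coll_integral (Q_integrand \<mu> g h l)"
  by (simp add: fun_eq_iff Q_formula_def coll_integral_def)

lemma norm_to_H_coll_integral_le:
  assumes I: "collision_measurable I" "coll_energy I \<le> ennreal (c\<^sup>2)" and c: "0 \<le> c"
  shows "norm (to_H (coll_integral I)) \<le> c"
proof -
  have "coll_integral I \<in> square_integrable"
    using I by (intro coll_integral_square_integrable) (auto intro: order.strict_trans1)
  then have "ennreal ((norm (to_H (coll_integral I)))\<^sup>2) \<le> ennreal (c\<^sup>2)"
    using norm_to_H_power2 energy_coll_integral_le I(2) order_trans by metis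
  then have "(norm (to_H (coll_integral I)))\<^sup>2 \<le> c\<^sup>2"
    by simp
  then show ?thesis
    using c by (simp add: power2_le_iff_abs_le)
qed

context
  fixes \<mu> :: real
  assumes mu: "0 < \<mu>"
begin

lemma Gamma_slots:
  assumes "u \<in> square_integrable"
  shows "integrand_slot (\<lambda>g. Gamma_integrand \<mu> g u) (Gamma_const \<mu> * energy u)"
    and "integrand_slot (\<lambda>h. Gamma_integrand \<mu> u h) (Gamma_const \<mu> * energy u)"
proof -
  have fin: "Gamma_const \<mu> * energy u < \<infinity>"
    using assms const_finite[OF mu] by (auto simp: ennreal_mult_less_top square_integrable_iff)
  show "integrand_slot (\<lambda>g. Gamma_integrand \<mu> g u) (Gamma_const \<mu> * energy u)"
  proof
    show "coll_energy (Gamma_integrand \<mu> g u) \<le> Gamma_const \<mu> * energy u * energy g"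
      if "g \<in> square_integrable" for g
      using Gamma_energy_le[OF mu that assms] by (simp add: mult_ac)
  qed (use fin assms in \<open>auto intro!: Gamma_integrand_measurable ext simp: Gamma_integrand_def Let_def ring_distribs\<close>)
  show "integrand_slot (\<lambda>h. Gamma_integrand \<mu> u h) (Gamma_const \<mu> * energy u)"
  proof
    show "coll_energy (Gamma_integrand \<mu> u g) \<le> Gamma_const \<mu> * energy u * energy g"
      if "g \<in> square_integrable" for g
      using Gamma_energy_le[OF mu assms that] by (simp add: mult_ac)
  qed (use fin assms in \<open>auto intro!: Gamma_integrand_measurable ext simp: Gamma_integrand_def Let_def ring_distribs\<close>)
qed

lemma Q_slots:
  assumes "u \<in> square_integrable" "v \<in> square_integrable"
  shows "integrand_slot (\<lambda>g. Q_integrand \<mu> g u v) (Q_const \<mu> * (energy u * energy v))"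
    and "integrand_slot (\<lambda>h. Q_integrand \<mu> u h v) (Q_const \<mu> * (energy u * energy v))"
    and "integrand_slot (\<lambda>l. Q_integrand \<mu> u v l) (Q_const \<mu> * (energy u * energy v))"
proof -
  have fin: "Q_const \<mu> * (energy u * energy v) < \<infinity>"
    using assms const_finite[OF mu] by (auto simp: ennreal_mult_less_top square_integrable_iff)
  show "integrand_slot (\<lambda>g. Q_integrand \<mu> g u v) (Q_const \<mu> * (energy u * energy v))"
  proof
    show "coll_energy (Q_integrand \<mu> g u v) \<le> Q_const \<mu> * (energy u * energy v) * energy g"
      if "g \<in> square_integrable" for g
      using Q_energy_le[OF mu that assms] by (simp add: mult_ac)
  qed (use fin assms in \<open>auto intro!: Q_integrand_measurable ext simp: Q_integrand_def Let_def ring_distribs\<close>)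
  show "integrand_slot (\<lambda>h. Q_integrand \<mu> u h v) (Q_const \<mu> * (energy u * energy v))"
  proof
    show "coll_energy (Q_integrand \<mu> u g v) \<le> Q_const \<mu> * (energy u * energy v) * energy g"
      if "g \<in> square_integrable" for g
      using Q_energy_le[OF mu assms(1) that assms(2)] by (simp add: mult_ac)
  qed (use fin assms in \<open>auto intro!: Q_integrand_measurable ext simp: Q_integrand_def Let_def ring_distribs\<close>)
  show "integrand_slot (\<lambda>l. Q_integrand \<mu> u v l) (Q_const \<mu> * (energy u * energy v))"
  proof
    show "coll_energy (Q_integrand \<mu> u v g) \<le> Q_const \<mu> * (energy u * energy v) * energy g"
      if "g \<in> square_integrable" for g
      using Q_energy_le[OF mu assms that] by (simp add: mult_ac)
  qed (use fin assms in \<open>auto intro!: Q_integrand_measurable ext simp: Q_integrand_def Let_def ring_distribs\<close>)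
qed

text \<open>The formula converges almost everywhere for all square-integrable functions, so the extension is the formula itself at chosen representatives, instead of a limit along test functions.\<close>

definition Gamma_map :: "hspace \<Rightarrow> hspace \<Rightarrow> hspace" where
  "Gamma_map x y = to_H (coll_integral (Gamma_integrand \<mu> (rep_hspace x) (rep_hspace y)))"

definition Q_map :: "hspace \<Rightarrow> hspace \<Rightarrow> hspace \<Rightarrow> hspace" where
  "Q_map x y z = to_H (coll_integral (Q_integrand \<mu> (rep_hspace x) (rep_hspace y) (rep_hspace z)))"

lemma energy_rep: "energy (rep_hspace x) = ennreal ((norm x)\<^sup>2)"
  using norm_to_H_power2[OF rep_hspace(1)[of x]] by (simp add: rep_hspace(2))

text \<open>Independence of the representatives is obtained in one argument after the other.\<close>

lemma Gamma_map_to_H: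
  assumes "g \<in> square_integrable" "h \<in> square_integrable"
  shows "Gamma_map (to_H g) (to_H h) = to_H (Gamma_formula \<mu> g h)"
proof -
  interpret first: integrand_slot "\<lambda>g. Gamma_integrand \<mu> g (rep_hspace (to_H h))" "Gamma_const \<mu> * energy (rep_hspace (to_H h))"
    by (rule Gamma_slots(1)[OF rep_hspace(1)])
  interpret second: integrand_slot "\<lambda>h. Gamma_integrand \<mu> g h" "Gamma_const \<mu> * energy g"
    by (rule Gamma_slots(2)[OF assms(1)])
  show ?thesis
    using first.slot_map_rep_to_H[OF assms(1)] second.slot_map_rep_to_H[OF assms(2)]
    by (simp add: Gamma_map_def Gamma_formula_eq first.slot_map_def second.slot_map_def)
qed

text \<open>As for \<open>Gamma_map\<close>, the representatives are exchanged one at a time.\<close>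

lemma Q_map_to_H:
  assumes "g \<in> square_integrable" "h \<in> square_integrable" "l \<in> square_integrable"
  shows "Q_map (to_H g) (to_H h) (to_H l) = to_H (Q_formula \<mu> g h l)"
proof -
  let ?h = "rep_hspace (to_H h)" and ?l = "rep_hspace (to_H l)"
  interpret first: integrand_slot "\<lambda>g. Q_integrand \<mu> g ?h ?l" "Q_const \<mu> * (energy ?h * energy ?l)"
    by (rule Q_slots(1)[OF rep_hspace(1) rep_hspace(1)])
  interpret second: integrand_slot "\<lambda>h. Q_integrand \<mu> g h ?l" "Q_const \<mu> * (energy g * energy ?l)"
    by (rule Q_slots(2)[OF assms(1) rep_hspace(1)])
  interpret third: integrand_slot "\<lambda>l. Q_integrand \<mu> g h l" "Q_const \<mu> * (energy g * energy h)"
    by (rule Q_slots(3)[OF assms(1,2)])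
  show ?thesis
    using first.slot_map_rep_to_H[OF assms(1)] second.slot_map_rep_to_H[OF assms(2)] third.slot_map_rep_to_H[OF assms(3)]
    by (simp add: Q_map_def Q_formula_eq first.slot_map_def second.slot_map_def third.slot_map_def)
qed

definition collision_bound :: real where
  "collision_bound = max (sqrt (enn2real (Gamma_const \<mu>))) (sqrt (enn2real (Q_const \<mu>)))"

lemma collision_bound: "0 \<le> collision_bound"
  "Gamma_const \<mu> \<le> ennreal (collision_bound\<^sup>2)" "Q_const \<mu> \<le> ennreal (collision_bound\<^sup>2)"
proof -
  show nn: "0 \<le> collision_bound" by (simp add: collision_bound_def le_max_iff_disj)
  have *: "K \<le> ennreal (collision_bound\<^sup>2)" if "K < \<infinity>" "sqrt (enn2real K) \<le> collision_bound" for K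
  proof -
    have "K = ennreal ((sqrt (enn2real K))\<^sup>2)"
      using that(1) by (simp add: ennreal_enn2real)
    also have "\<dots> \<le> ennreal (collision_bound\<^sup>2)"
      using that(2) by (intro ennreal_leI power_mono) auto
    finally show ?thesis .
  qed
  show "Gamma_const \<mu> \<le> ennreal (collision_bound\<^sup>2)" "Q_const \<mu> \<le> ennreal (collision_bound\<^sup>2)"
    by (rule *; use const_finite[OF mu] in \<open>simp add: collision_bound_def\<close>)+
qed

lemma norm_Gamma_map_le: "norm (Gamma_map x y) \<le> collision_bound * norm x * norm y"
  unfolding Gamma_map_def
proof (rule norm_to_H_coll_integral_le[OF Gamma_integrand_measurable[OF rep_hspace(1) rep_hspace(1)]])
  have "coll_energy (Gamma_integrand \<mu> (rep_hspace x) (rep_hspace y)) \<le>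
      ennreal (collision_bound\<^sup>2) * (ennreal ((norm x)\<^sup>2) * ennreal ((norm y)\<^sup>2))"
    using Gamma_energy_le[OF mu rep_hspace(1) rep_hspace(1), of x y] mult_right_mono[OF collision_bound(2)]
    unfolding energy_rep by (rule order_trans) simp
  then show "coll_energy (Gamma_integrand \<mu> (rep_hspace x) (rep_hspace y)) \<le>
      ennreal ((collision_bound * norm x * norm y)\<^sup>2)"
    by (simp add: power_mult_distrib mult.assoc flip: ennreal_mult)
qed (simp add: collision_bound)

lemma norm_Q_map_le: "norm (Q_map x y z) \<le> collision_bound * norm x * norm y * norm z"
  unfolding Q_map_def
proof (rule norm_to_H_coll_integral_le[OF Q_integrand_measurable[OF rep_hspace(1) rep_hspace(1) rep_hspace(1)]])
  have "coll_energy (Q_integrand \<mu> (rep_hspace x) (rep_hspace y) (rep_hspace z)) \<le>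
      ennreal (collision_bound\<^sup>2) * (ennreal ((norm x)\<^sup>2) * ennreal ((norm y)\<^sup>2) * ennreal ((norm z)\<^sup>2))"
    using Q_energy_le[OF mu rep_hspace(1) rep_hspace(1) rep_hspace(1), of x y z] mult_right_mono[OF collision_bound(3)]
    unfolding energy_rep by (rule order_trans) simp
  then show "coll_energy (Q_integrand \<mu> (rep_hspace x) (rep_hspace y) (rep_hspace z)) \<le>
      ennreal ((collision_bound * norm x * norm y * norm z)\<^sup>2)"
    by (simp add: power_mult_distrib mult.assoc flip: ennreal_mult)
qed (simp add: collision_bound)

lemma Gamma_map_linear: "linear (\<lambda>x. Gamma_map x y)" "linear (\<lambda>y. Gamma_map x y)"
proof -
  interpret first: integrand_slot "\<lambda>g. Gamma_integrand \<mu> g (rep_hspace y)" "Gamma_const \<mu> * energy (rep_hspace y)"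
    by (rule Gamma_slots(1)[OF rep_hspace(1)])
  interpret second: integrand_slot "\<lambda>h. Gamma_integrand \<mu> (rep_hspace x) h" "Gamma_const \<mu> * energy (rep_hspace x)"
    by (rule Gamma_slots(2)[OF rep_hspace(1)])
  show "linear (\<lambda>x. Gamma_map x y)" "linear (\<lambda>y. Gamma_map x y)"
    using first.linear_slot_map second.linear_slot_map by (simp_all add: Gamma_map_def first.slot_map_def second.slot_map_def)
qed

lemma Q_map_linear: "linear (\<lambda>x. Q_map x y z)" "linear (\<lambda>y. Q_map x y z)" "linear (\<lambda>z. Q_map x y z)"
proof -
  let ?x = "rep_hspace x" and ?y = "rep_hspace y" and ?z = "rep_hspace z"
  interpret first: integrand_slot "\<lambda>g. Q_integrand \<mu> g ?y ?z" "Q_const \<mu> * (energy ?y * energy ?z)"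
    by (rule Q_slots(1)[OF rep_hspace(1) rep_hspace(1)])
  interpret second: integrand_slot "\<lambda>h. Q_integrand \<mu> ?x h ?z" "Q_const \<mu> * (energy ?x * energy ?z)"
    by (rule Q_slots(2)[OF rep_hspace(1) rep_hspace(1)])
  interpret third: integrand_slot "\<lambda>l. Q_integrand \<mu> ?x ?y l" "Q_const \<mu> * (energy ?x * energy ?y)"
    by (rule Q_slots(3)[OF rep_hspace(1) rep_hspace(1)])
  show "linear (\<lambda>x. Q_map x y z)" "linear (\<lambda>y. Q_map x y z)" "linear (\<lambda>z. Q_map x y z)"
    using first.linear_slot_map second.linear_slot_map third.linear_slot_map
    by (simp_all add: Q_map_def first.slot_map_def second.slot_map_def third.slot_map_def)
qed

lemma Gamma_map_extension: "Gamma_extension \<mu> Gamma_map"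
proof -
  have "bounded_bilinear Gamma_map"
  proof
    show "\<exists>K. \<forall>a b. norm (Gamma_map a b) \<le> norm a * norm b * K"
      using norm_Gamma_map_le by (intro exI[of _ collision_bound]) (simp add: mult_ac)
  qed (simp_all add: linear_add[OF Gamma_map_linear(1)] linear_add[OF Gamma_map_linear(2)]
      linear_scale[OF Gamma_map_linear(1)] linear_scale[OF Gamma_map_linear(2)])
  moreover have "Gamma_formula \<mu> g h \<in> square_integrable" if "g \<in> test_functions" "h \<in> test_functions" for g h
  proof -
    have sq: "g \<in> square_integrable" "h \<in> square_integrable"
      using that test_functions_square_integrable by auto
    interpret integrand_slot "\<lambda>h. Gamma_integrand \<mu> g h" "Gamma_const \<mu> * energy g"
      by (rule Gamma_slots(2)[OF sq(1)])
    show ?thesis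
      unfolding Gamma_formula_eq by (rule formula_square_integrable[OF sq(2)])
  qed
  ultimately show ?thesis
    using Gamma_map_to_H test_functions_square_integrable by (auto simp: Gamma_extension_def subset_iff)
qed

lemma Q_map_extension: "Q_extension \<mu> Q_map"
proof -
  have "bounded_trilinear Q_map"
    using Q_map_linear norm_Q_map_le by (auto simp: bounded_trilinear_def)
  moreover have "Q_formula \<mu> g h l \<in> square_integrable"
    if "g \<in> test_functions" "h \<in> test_functions" "l \<in> test_functions" for g h l
  proof -
    have sq: "g \<in> square_integrable" "h \<in> square_integrable" "l \<in> square_integrable"
      using that test_functions_square_integrable by auto
    interpret integrand_slot "\<lambda>l. Q_integrand \<mu> g h l" "Q_const \<mu> * (energy g * energy h)"
      by (rule Q_slots(3)[OF sq(1,2)])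
    show ?thesis
      unfolding Q_formula_eq by (rule formula_square_integrable[OF sq(3)])
  qed
  ultimately show ?thesis
    using Q_map_to_H test_functions_square_integrable by (auto simp: Q_extension_def subset_iff)
qed

end

section \<open>Smooth bumps\<close>

text \<open>Recursion on the derivative makes closure under sums, products and affine substitutions a plain induction, which iterated \<open>deriv\<close> does not offer.\<close>

fun n_times_differentiable :: "nat \<Rightarrow> (real \<Rightarrow> real) \<Rightarrow> bool" where
  "n_times_differentiable 0 f \<longleftrightarrow> True"
| "n_times_differentiable (Suc n) f \<longleftrightarrow>
     (\<exists>f'. (\<forall>x. (f has_real_derivative f' x) (at x)) \<and> n_times_differentiable n f')"

lemma n_times_differentiable_Suc_imp:
  "n_times_differentiable (Suc n) f \<Longrightarrow> n_times_differentiable n f"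
proof (induction n arbitrary: f)
  case (Suc n)
  from Suc.prems obtain f' where "\<forall>x. (f has_real_derivative f' x) (at x)" "n_times_differentiable (Suc n) f'"
    using n_times_differentiable.simps(2)[of "Suc n" f] by blast
  then show ?case
    using Suc.IH[of f'] n_times_differentiable.simps(2)[of n f] by blast
qed simp

lemma n_times_differentiable_const: "n_times_differentiable n (\<lambda>_. c)"
proof (induction n arbitrary: c)
  case (Suc n)
  have "\<forall>x. ((\<lambda>_. c) has_real_derivative 0) (at x)" by simp
  then show ?case
    unfolding n_times_differentiable.simps using Suc.IH[of 0] by (intro exI[of _ "\<lambda>_. 0"] conjI)
qed simp

lemma n_times_differentiable_add:
  "n_times_differentiable n f \<Longrightarrow> n_times_differentiable n g \<Longrightarrow> n_times_differentiable n (\<lambda>x. f x + g x)"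
proof (induction n arbitrary: f g)
  case (Suc n)
  then obtain f' g' where d: "\<And>x. (f has_real_derivative f' x) (at x)" "n_times_differentiable n f'"
    "\<And>x. (g has_real_derivative g' x) (at x)" "n_times_differentiable n g'"
    by auto
  then have "\<forall>x. ((\<lambda>x. f x + g x) has_real_derivative f' x + g' x) (at x)"
    by (auto intro!: derivative_eq_intros)
  then show ?case
    unfolding n_times_differentiable.simps using Suc.IH[OF d(2,4)]
    by (intro exI[of _ "\<lambda>x. f' x + g' x"] conjI)
qed simp

lemma n_times_differentiable_mult:
  "n_times_differentiable n f \<Longrightarrow> n_times_differentiable n g \<Longrightarrow> n_times_differentiable n (\<lambda>x. f x * g x)"
proof (induction n arbitrary: f g)
  case (Suc n)
  then obtain f' g' where d: "\<And>x. (f has_real_derivative f' x) (at x)" "n_times_differentiable n f'"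
    "\<And>x. (g has_real_derivative g' x) (at x)" "n_times_differentiable n g'"
    by auto
  then have "\<forall>x. ((\<lambda>x. f x * g x) has_real_derivative f' x * g x + g' x * f x) (at x)"
    by (auto intro: DERIV_mult)
  moreover have "n_times_differentiable n (\<lambda>x. f' x * g x + g' x * f x)"
    using n_times_differentiable_Suc_imp[OF Suc.prems(1)] n_times_differentiable_Suc_imp[OF Suc.prems(2)] d
    by (intro n_times_differentiable_add Suc.IH)
  ultimately show ?case
    unfolding n_times_differentiable.simps by (intro exI[of _ "\<lambda>x. f' x * g x + g' x * f x"] conjI)
qed simp

lemma n_times_differentiable_affine:
  "n_times_differentiable n f \<Longrightarrow> n_times_differentiable n (\<lambda>x. f (c * x + d))"
proof (induction n arbitrary: f)
  case (Suc n)
  then obtain f' where d: "\<And>x. (f has_real_derivative f' x) (at x)" "n_times_differentiable n f'"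
    by auto
  have "\<forall>x. ((\<lambda>x. f (c * x + d)) has_real_derivative f' (c * x + d) * c) (at x)"
    by (intro allI DERIV_chain2[of f] d(1)) (auto intro!: derivative_eq_intros)
  moreover have "n_times_differentiable n (\<lambda>x. f' (c * x + d) * c)"
    by (intro n_times_differentiable_mult n_times_differentiable_const Suc.IH d)
  ultimately show ?case
    unfolding n_times_differentiable.simps by (intro exI[of _ "\<lambda>x. f' (c * x + d) * c"] conjI)
qed simp

lemma funpow_deriv_differentiable:
  "n_times_differentiable (Suc k) f \<Longrightarrow> (deriv ^^ k) f differentiable at x"
proof (induction k arbitrary: f)
  case 0
  then show ?case by (auto simp: real_differentiable_def)
next
  case (Suc k)
  then obtain f' where d: "\<And>x. (f has_real_derivative f' x) (at x)" "n_times_differentiable (Suc k) f'"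
    using n_times_differentiable.simps(2)[of "Suc k" f] by blast
  then have "deriv f = f'"
    by (auto intro: DERIV_imp_deriv)
  then show ?case
    using Suc.IH[OF d(2)] by (simp add: funpow_Suc_right del: funpow.simps)
qed

text \<open>The functions $q(1/x)\,e^{-1/x}$ for $x > 0$, extended by zero. The polynomial is a parameter so that the family is closed under differentiation, which gives smoothness at once.\<close>

definition flat :: "real poly \<Rightarrow> real \<Rightarrow> real" where
  "flat p x = (if x \<le> 0 then 0 else poly p (inverse x) * exp (- inverse x))"

lemma poly_times_exp_minus_tendsto_0: "((\<lambda>t. poly p t * exp (- t)) \<longlongrightarrow> (0::real)) at_top"
proof -
  have "((\<lambda>t. \<Sum>i\<le>degree p. coeff p i * (t ^ i / exp t)) \<longlongrightarrow> (\<Sum>i\<le>degree p. coeff p i * 0)) at_top"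
    by (intro tendsto_intros tendsto_power_div_exp_0)
  then show ?thesis
    by (simp add: poly_altdef exp_minus sum_distrib_right divide_inverse mult.assoc)
qed

text \<open>For positive \<open>x\<close> the chain rule produces the factor $1/x^2$, that is, multiplication of the polynomial by $X^2$. At zero the difference quotient is again of the form $q(1/h)\,e^{-1/h}$, which tends to zero because the exponential beats every polynomial.\<close>

lemma flat_has_derivative:
  "(flat p has_real_derivative flat ((p - pderiv p) * [:0, 0, 1:]) x) (at x)"
proof -
  consider "x < 0" | "x = 0" | "0 < x" by linarith
  then show ?thesis
  proof cases
    case 1
    have "((\<lambda>_. 0) has_real_derivative 0) (at x)" by simp
    then have "(flat p has_real_derivative 0) (at x)"
      by (rule has_field_derivative_transform_within_open[where S = "{..<0}"]) (use 1 in \<open>auto simp: flat_def\<close>)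
    then show ?thesis using 1 by (simp add: flat_def)
  next
    case 3
    have "((\<lambda>x. poly p (inverse x) * exp (- inverse x)) has_real_derivative
        (poly p (inverse x) * (exp (- inverse x) * (inverse x * inverse x)) +
         (poly (pderiv p) (inverse x) * - (inverse x * inverse x)) * exp (- inverse x))) (at x)"
      using 3 by (auto intro!: derivative_eq_intros DERIV_chain2[OF poly_DERIV] simp: power2_eq_square)
    then have "(flat p has_real_derivative
        (poly p (inverse x) * (exp (- inverse x) * (inverse x * inverse x)) +
         (poly (pderiv p) (inverse x) * - (inverse x * inverse x)) * exp (- inverse x))) (at x)"
      by (rule has_field_derivative_transform_within_open[where S = "{0<..}"]) (use 3 in \<open>auto simp: flat_def\<close>)
    then show ?thesis using 3 by (simp add: flat_def algebra_simps)
  next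
    case 2
    have "((\<lambda>h. poly (p * [:0, 1:]) (inverse h) * exp (- inverse h)) \<longlongrightarrow> 0) (at_right 0)"
      by (rule filterlim_compose[OF poly_times_exp_minus_tendsto_0 filterlim_inverse_at_top_right])
    moreover have "eventually (\<lambda>h. poly (p * [:0, 1:]) (inverse h) * exp (- inverse h) = flat p h / h) (at_right 0)"
      using eventually_at_right_less by eventually_elim (simp add: flat_def divide_inverse mult_ac)
    ultimately have "((\<lambda>h. flat p h / h) \<longlongrightarrow> 0) (at_right 0)"
      by (rule Lim_transform_eventually)
    moreover have "((\<lambda>h. flat p h / h) \<longlongrightarrow> 0) (at_left 0)"
    proof (rule Lim_transform_eventually[OF tendsto_const])
      have "eventually (\<lambda>h::real. h < 0) (at_left 0)"
        by (simp add: eventually_at_filter)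
      then show "eventually (\<lambda>h. 0 = flat p h / h) (at_left 0)"
        by eventually_elim (simp add: flat_def)
    qed
    ultimately have "((\<lambda>h. flat p h / h) \<longlongrightarrow> 0) (at 0)"
      by (rule filterlim_split_at[rotated])
    then show ?thesis
      using 2 by (simp add: DERIV_def flat_def)
  qed
qed

lemma flat_n_times_differentiable: "n_times_differentiable n (flat p)"
proof (induction n arbitrary: p)
  case (Suc n)
  then show ?case using flat_has_derivative by auto
qed simp

text \<open>The product of $e^{-1/(N(x-a))}$ and $e^{-1/(N(b-x))}$ on the interval, with \<open>N = Suc n\<close> (avoiding \<open>N = 0\<close>). As \<open>N\<close> grows both exponents tend to zero inside the interval, while the bump stays below its indicator.\<close>

definition bump :: "nat \<Rightarrow> real \<Rightarrow> real \<Rightarrow> real \<Rightarrow> real" where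
  "bump n a b x = flat 1 (real (Suc n) * (x - a)) * flat 1 (real (Suc n) * (b - x))"

lemma bump_n_times_differentiable: "n_times_differentiable k (bump n a b)"
proof -
  have "n_times_differentiable k (\<lambda>x. flat 1 (real (Suc n) * x + - (real (Suc n) * a)) *
      flat 1 (- real (Suc n) * x + real (Suc n) * b))"
    by (intro n_times_differentiable_mult n_times_differentiable_affine flat_n_times_differentiable)
  also have "(\<lambda>x. flat 1 (real (Suc n) * x + - (real (Suc n) * a)) *
      flat 1 (- real (Suc n) * x + real (Suc n) * b)) = bump n a b"
    by (simp add: bump_def fun_eq_iff algebra_simps)
  finally show ?thesis .
qed

lemma bump_bounds: "0 \<le> bump n a b x" "bump n a b x \<le> indicator {a<..<b} x"
proof -
  have flat: "0 \<le> flat 1 y" "flat 1 y \<le> 1" "y \<le> 0 \<Longrightarrow> flat 1 y = 0" for y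
    by (auto simp: flat_def)
  show "0 \<le> bump n a b x"
    by (simp add: bump_def flat)
  show "bump n a b x \<le> indicator {a<..<b} x"
    using flat by (auto simp: bump_def indicator_def mult_le_one flat(3) mult_le_0_iff not_less)
qed

lemma bump_test_function:
  assumes "0 < a"
  shows "bump n a b \<in> test_functions"
proof -
  have "bump n a b x = 0" if "x \<notin> {a..b}" for x
    using bump_bounds[of n a b x] that by (auto simp: indicator_def of_bool_def split: if_splits)
  then have "{x. bump n a b x \<noteq> 0} \<subseteq> {a..b}"
    by blast
  then have sub: "closure {x. bump n a b x \<noteq> 0} \<subseteq> {a..b}"
    by (rule closure_minimal) simp
  then have "compact (closure {x. bump n a b x \<noteq> 0})"
    using compact_Icc closed_closure compact_Int_closed[of "{a..b}" "closure {x. bump n a b x \<noteq> 0}"]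
    by (simp add: Int_absorb1)
  then show ?thesis
    using sub assms funpow_deriv_differentiable[OF bump_n_times_differentiable]
    by (force simp: test_functions_def)
qed

lemma bump_tendsto: "(\<lambda>n. bump n a b x) \<longlonglongrightarrow> indicator {a<..<b} x"
proof (cases "x \<in> {a<..<b}")
  case True
  have *: "(\<lambda>n. flat 1 (real (Suc n) * y)) \<longlonglongrightarrow> 1" if "0 < y" for y
  proof -
    have "(\<lambda>n. exp (- (inverse (real (Suc n)) * inverse y))) \<longlonglongrightarrow> exp (- (0 * inverse y))"
      by (intro tendsto_intros LIMSEQ_inverse_real_of_nat)
    moreover have "flat 1 (real (Suc n) * y) = exp (- (inverse (real (Suc n)) * inverse y))" for n
    proof -
      have "0 < real (Suc n) * y" using that by (intro mult_pos_pos) auto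
      then show ?thesis by (simp add: flat_def del: of_nat_Suc)
    qed
    ultimately show ?thesis by simp
  qed
  show ?thesis
    using tendsto_mult[OF *[of "x - a"] *[of "b - x"]] True by (simp add: bump_def del: of_nat_Suc)
next
  case False
  then have "bump n a b x = 0" for n
    using bump_bounds[of n a b x] by simp
  then show ?thesis using False by simp
qed

lemma square_integrable_bound:
  assumes "w \<in> square_integrable" "f \<in> borel_measurable weight_measure" "\<And>x. 0 < x \<Longrightarrow> \<bar>f x\<bar> \<le> \<bar>w x\<bar>"
  shows "f \<in> square_integrable"
proof -
  have "energy f \<le> energy w"
    unfolding energy_def using assms(3) by (intro nn_integral_mono ennreal_leI) (simp add: abs_le_square_iff)
  then show ?thesis
    using assms by (auto simp: square_integrable_iff intro: order.strict_trans1)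
qed

text \<open>Dominated convergence for the squared differences.\<close>

lemma to_H_dominated_tendsto:
  assumes w: "w \<in> square_integrable" and s: "\<And>n. s n \<in> borel_measurable weight_measure"
    and f: "f \<in> borel_measurable weight_measure"
    and bound: "\<And>n x. 0 < x \<Longrightarrow> \<bar>s n x\<bar> \<le> \<bar>w x\<bar>"
    and lim: "\<And>x. 0 < x \<Longrightarrow> (\<lambda>n. s n x) \<longlonglongrightarrow> f x"
  shows "(\<lambda>n. to_H (s n)) \<longlonglongrightarrow> to_H f"
proof -
  note [measurable] = s f
  have fb: "\<bar>f x\<bar> \<le> \<bar>w x\<bar>" if "0 < x" for x
    using LIMSEQ_le_const2[OF tendsto_rabs[OF lim[OF that]]] bound[OF that] by blast
  have sq: "s n \<in> square_integrable" "f \<in> square_integrable" for n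
    using bound fb by (auto intro!: square_integrable_bound[OF w])
  have "(\<lambda>n. \<integral>x. (s n x - f x)\<^sup>2 \<partial>weight_measure) \<longlonglongrightarrow> (\<integral>x. 0 \<partial>weight_measure)"
  proof (rule integral_dominated_convergence[where w = "\<lambda>x. 4 * (w x)\<^sup>2"])
    show "integrable weight_measure (\<lambda>x. 4 * (w x)\<^sup>2)"
      using w by (simp add: square_integrable_def)
    show "AE x in weight_measure. (\<lambda>n. (s n x - f x)\<^sup>2) \<longlonglongrightarrow> 0"
      using lim by (intro AE_I2) (auto intro!: tendsto_eq_intros)
    show "AE x in weight_measure. norm ((s n x - f x)\<^sup>2) \<le> 4 * (w x)\<^sup>2" for n
    proof (rule AE_I2)
      fix x assume "x \<in> space weight_measure"
      then have "\<bar>s n x - f x\<bar> \<le> \<bar>2 * w x\<bar>"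
        using bound[of x n] fb[of x] by auto
      then show "norm ((s n x - f x)\<^sup>2) \<le> 4 * (w x)\<^sup>2"
        by (simp add: abs_le_square_iff power_mult_distrib)
    qed
  qed simp_all
  moreover have "(\<integral>x. (s n x - f x)\<^sup>2 \<partial>weight_measure) = (norm (to_H (s n) - to_H f))\<^sup>2" for n
    using square_integrable_diff[OF sq, of n]
    unfolding to_H_diff[OF sq] power2_norm_eq_inner unfolding to_H_def
    by (subst inner_hspace.abs_eq) (auto simp: H_rel_def power2_eq_square)
  ultimately have "(\<lambda>n. (norm (to_H (s n) - to_H f))\<^sup>2) \<longlonglongrightarrow> 0"
    by simp
  from tendsto_real_sqrt[OF this] have "(\<lambda>n. norm (to_H (s n) - to_H f)) \<longlonglongrightarrow> 0"
    by simp
  then show ?thesis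
    by (simp add: tendsto_norm_zero_iff LIM_zero_iff)
qed

section \<open>Density of test functions\<close>

lemma indicator_square_integrable:
  fixes A :: "real set" and c d :: real
  assumes [measurable]: "A \<in> sets borel" and "A \<subseteq> {c<..<d}"
  shows "indicator A \<in> square_integrable"
proof -
  have meas: "(indicator A :: real \<Rightarrow> real) \<in> borel_measurable weight_measure"
    by (intro borel_imp_measurable_weight) simp
  have "energy (indicator A) = (\<integral>\<^sup>+x. ennreal (sqrt x) * ennreal ((indicator A x)\<^sup>2) * indicator {0<..} x \<partial>lborel)"
    unfolding energy_def by (intro nn_integral_weight_measure borel_imp_measurable_weight) measurable
  also have "\<dots> \<le> (\<integral>\<^sup>+x. ennreal (sqrt d) * indicator {c<..<d} x \<partial>lborel)"
    using assms(2) by (intro nn_integral_mono) (auto simp: indicator_def intro!: ennreal_leI)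
  also have "\<dots> < \<infinity>"
    by (subst nn_integral_cmult) (use emeasure_bounded_finite[of "{c<..<d}"] in \<open>auto simp: ennreal_mult_less_top\<close>)
  finally show ?thesis
    using meas by (simp add: square_integrable_iff)
qed

lemma to_H_sum_in_subspace:
  assumes V: "subspace V" and "finite F"
    and u: "\<And>y. y \<in> F \<Longrightarrow> u y \<in> square_integrable \<and> to_H (u y) \<in> V"
  shows "(\<lambda>x. \<Sum>y\<in>F. u y x) \<in> square_integrable \<and> to_H (\<lambda>x. \<Sum>y\<in>F. u y x) \<in> V"
  using assms(2,1) u
proof (induction F rule: finite_induct)
  case empty
  have "to_H (\<lambda>_. 0) = 0"
    by (simp add: to_H_def zero_hspace_def)
  then show ?case
    using V by (simp add: square_integrable_zero subspace_0)
next
  case (insert y F)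
  then show ?case
    by (auto simp: to_H_add[symmetric] intro!: square_integrable_add subspace_add[OF V])
qed

text \<open>Open intervals are limits of bumps, and the sets whose indicators lie in \<open>V\<close> form a Dynkin system: complements need the subspace property, countable disjoint unions the closedness. Intersecting with a fixed interval away from zero keeps every indicator square integrable.\<close>

lemma to_H_indicator_in_closed_subspace:
  assumes V: "subspace V" "closed V" and tests: "to_H ` test_functions \<subseteq> V"
    and A: "A \<in> sets borel" and cd: "0 < c"
  shows "to_H (indicator (A \<inter> {c<..<d})) \<in> V"
proof -
  define I where "I = {c<..<d}"
  have sq: "indicator (A \<inter> I) \<in> square_integrable" if "A \<in> sets borel" for A
    using that by (intro indicator_square_integrable[of _ c d]) (auto simp: I_def)
  have interval: "to_H (indicator {a<..<b}) \<in> V" if "0 < a" for a b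
  proof (rule closed_sequentially[OF V(2)])
    have "(indicator {a<..<b} :: real \<Rightarrow> real) \<in> square_integrable"
      by (intro indicator_square_integrable[of _ a b]) auto
    then show "(\<lambda>n. to_H (bump n a b)) \<longlonglongrightarrow> to_H (indicator {a<..<b})"
      using bump_test_function[OF that, of _ b] test_functions_square_integrable bump_bounds bump_tendsto
      by (intro to_H_dominated_tendsto[where w = "indicator {a<..<b}"])
         (auto simp: square_integrable_measurable subset_eq)
    show "to_H (bump n a b) \<in> V" for n
      using bump_test_function[OF that, of _ b] tests by auto
  qed
  have sets: "A \<in> sets borel" if "A \<in> sigma_sets UNIV (range (\<lambda>(a, b). {a<..<b}))" for A :: "real set"
    using that by (subst borel_eq_box) (simp add: box_real case_prod_beta)
  have "to_H (indicator (A \<inter> I)) \<in> V"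
  proof -
    have "Int_stable (range (\<lambda>(a, b). {a<..<b :: real}))"
    proof (rule Int_stableI)
      fix S T assume "S \<in> range (\<lambda>(a, b). {a<..<b :: real})" "T \<in> range (\<lambda>(a, b). {a<..<b :: real})"
      then obtain a b a' b' where "S = {a<..<b}" "T = {a'<..<b'}" by auto
      then have "S \<inter> T = (\<lambda>(a, b). {a<..<b}) (max a a', min b b')" by auto
      then show "S \<inter> T \<in> range (\<lambda>(a, b). {a<..<b :: real})" by blast
    qed
    moreover have "range (\<lambda>(a, b). {a<..<b :: real}) \<subseteq> Pow UNIV" by simp
    moreover have "A \<in> sigma_sets UNIV (range (\<lambda>(a, b). {a<..<b}))"
      using A by (subst (asm) borel_eq_box) (simp add: box_real case_prod_beta)
    ultimately show ?thesis
    proof (induction rule: sigma_sets_induct_disjoint)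
      case (basic A)
      then obtain a b where "A = {a<..<b}" by auto
      then have "A \<inter> I = {max a c<..<min b d}" by (auto simp: I_def)
      then show ?case using interval[of "max a c" "min b d"] cd by simp
    next
      case empty
      show ?case
        using to_H_sum_in_subspace[OF V(1), of "{}"] by (simp add: indicator_def)
    next
      case (compl A)
      have "indicator ((UNIV - A) \<inter> I) = (\<lambda>x. indicator (UNIV \<inter> I) x - indicator (A \<inter> I) x :: real)"
        by (auto simp: indicator_def)
      moreover have "to_H (indicator (UNIV \<inter> I)) \<in> V"
        using interval[OF cd, of d] by (simp add: I_def)
      ultimately show ?case
        using compl sq[of UNIV] sq[OF sets[OF compl(1)]]
        by (simp add: to_H_diff[symmetric] subspace_diff[OF V(1)])
    next
      case (union A)
      have A: "A i \<in> sets borel" for i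
        using union(2) by (intro sets) auto
      define s where "s = (\<lambda>n x. \<Sum>i<n. indicator (A i \<inter> I) x :: real)"
      have s: "s n \<in> square_integrable \<and> to_H (s n) \<in> V" for n
        unfolding s_def using union(3) sq[OF A] by (intro to_H_sum_in_subspace[OF V(1)]) auto
      have sums: "(\<lambda>n. s n x) \<longlonglongrightarrow> indicator ((\<Union>i. A i) \<inter> I) x" for x
        using indicator_sums[of "\<lambda>i. A i \<inter> I" x] union(1)
        by (auto simp: s_def sums_def disjoint_family_on_def)
      have mono: "s n x \<le> s m x" if "n \<le> m" for n m x
        unfolding s_def using that by (intro sum_mono2) auto
      have "s n x \<le> indicator I x" for n x
      proof -
        have "s n x \<le> indicator ((\<Union>i. A i) \<inter> I) x"
          using incseq_le[OF _ sums, of x n] mono by (auto simp: incseq_def)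
        also have "\<dots> \<le> indicator I x" by (simp add: indicator_def)
        finally show ?thesis .
      qed
      moreover have "0 \<le> s n x" for n x
        by (auto simp: s_def intro!: sum_nonneg)
      ultimately have bound: "\<bar>s n x\<bar> \<le> \<bar>indicator I x\<bar>" for n x
        by (metis abs_of_nonneg order_trans)
      show ?case
      proof (rule closed_sequentially[OF V(2)])
        show "to_H (s n) \<in> V" for n using s by auto
        have "(\<Union>i. A i) \<in> sets borel" using A by auto
        then show "(\<lambda>n. to_H (s n)) \<longlonglongrightarrow> to_H (indicator ((\<Union>i. A i) \<inter> I))"
          using bound s sums sq[of UNIV] sq[of "\<Union>i. A i"]
          by (intro to_H_dominated_tendsto[where w = "indicator I"]) (auto intro: square_integrable_measurable)
      qed
    qed
  qed
  then show ?thesis by (simp add: I_def)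
qed

text \<open>Density of the test functions, in the form used for uniqueness. The approximating simple functions are cut off to intervals exhausting the half line and are dominated by twice the given function.\<close>

lemma closed_subspace_of_tests_UNIV:
  assumes V: "subspace V" "closed V" and tests: "to_H ` test_functions \<subseteq> V"
  shows "V = UNIV"
proof -
  have "x \<in> V" for x
  proof -
    obtain f where f: "f \<in> square_integrable" "x = to_H f"
      by (rule hspace_representative)
    define f' where "f' = (\<lambda>x. if 0 < x then f x else 0)"
    have f' [measurable]: "f' \<in> borel_measurable borel"
      unfolding f'_def using f(1) by (intro measurable_weight_imp_borel square_integrable_measurable)
    obtain s where s: "\<And>i. simple_function borel (s i)" "\<And>x. (\<lambda>i. s i x) \<longlonglongrightarrow> f' x"
        "\<And>i x. \<bar>s i x\<bar> \<le> 2 * \<bar>f' x\<bar>"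
    proof -
      obtain F where "(\<forall>i. simple_function borel (F i)) \<and> (\<forall>x\<in>space borel. (\<lambda>i. F i x) \<longlonglongrightarrow> f' x) \<and>
          (\<forall>i. \<forall>x\<in>space borel. dist (F i x) 0 \<le> 2 * dist (f' x) 0)"
        using borel_measurable_implies_sequence_metric[OF f', of 0] by blast
      then show ?thesis by (intro that[of F]) simp_all
    qed
    define I where "I = (\<lambda>i::nat. {inverse (real (Suc i))<..<real (Suc i)})"
    define t where "t = (\<lambda>i x. s i x * indicator (I i) x)"
    have t: "t i \<in> square_integrable \<and> to_H (t i) \<in> V" for i
    proof -
      have fin: "finite (range (s i))" and pre: "s i -` {y} \<in> sets borel" for y
        using simple_functionD[OF s(1), of i] by auto
      have t_eq: "t i = (\<lambda>x. \<Sum>y\<in>range (s i). y * indicator (s i -` {y} \<inter> I i) x)"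
      proof
        fix x
        have "s i x = (\<Sum>y\<in>range (s i). indicator (s i -` {y}) x *\<^sub>R y)"
          by (rule simple_function_indicator_representation_banach[OF s(1), of x i,
                unfolded space_borel Int_UNIV_right, OF UNIV_I])
        then have "t i x = (\<Sum>y\<in>range (s i). indicator (s i -` {y}) x *\<^sub>R y) * indicator (I i) x"
          unfolding t_def by (rule arg_cong)
        also have "\<dots> = (\<Sum>y\<in>range (s i). y * indicator (s i -` {y} \<inter> I i) x)"
          unfolding sum_distrib_right by (intro sum.cong refl) (simp add: indicator_inter_arith)
        finally show "t i x = (\<Sum>y\<in>range (s i). y * indicator (s i -` {y} \<inter> I i) x)" .
      qed
      have "(\<lambda>x. y * indicator (s i -` {y} \<inter> I i) x) \<in> square_integrable \<and>
          to_H (\<lambda>x. y * indicator (s i -` {y} \<inter> I i) x) \<in> V" for y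
      proof -
        have sq: "indicator (s i -` {y} \<inter> I i) \<in> square_integrable"
          using pre[of y] by (intro indicator_square_integrable[of _ "inverse (real (Suc i))" "real (Suc i)"])
            (auto simp: I_def)
        have "to_H (indicator (s i -` {y} \<inter> I i)) \<in> V"
          unfolding I_def using pre[of y] by (intro to_H_indicator_in_closed_subspace V tests) auto
        then show ?thesis
          using sq subspace_scale[OF V(1)] to_H_scaleR[OF sq] by (metis square_integrable_scale)
      qed
      then show ?thesis
        unfolding t_eq by (intro to_H_sum_in_subspace[OF V(1) fin])
    qed
    have lim: "(\<lambda>i. to_H (t i)) \<longlonglongrightarrow> to_H f"
    proof (rule to_H_dominated_tendsto)
      show "(\<lambda>x. 2 * f x) \<in> square_integrable"
        using f(1) by (rule square_integrable_scale)
      show "t i \<in> borel_measurable weight_measure" "f \<in> borel_measurable weight_measure" for i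
        using t f(1) by (auto intro: square_integrable_measurable)
      show "\<bar>t i x\<bar> \<le> \<bar>2 * f x\<bar>" if "0 < x" for i x
        using s(3)[of i x] that by (simp add: t_def f'_def indicator_def abs_mult)
      show "(\<lambda>i. t i x) \<longlonglongrightarrow> f x" if x: "0 < x" for x
      proof -
        have "eventually (\<lambda>i. inverse (real (Suc i)) < x) sequentially"
          using order_tendstoD(2)[OF LIMSEQ_inverse_real_of_nat x] .
        moreover have "eventually (\<lambda>i. x < real (Suc i)) sequentially"
        proof -
          obtain N where "x < real N" using reals_Archimedean2 by blast
          then show ?thesis by (intro eventually_sequentiallyI[of N]) simp
        qed
        ultimately have "eventually (\<lambda>i. s i x = t i x) sequentially"
          by eventually_elim (simp add: t_def I_def)
        then show ?thesis
          using Lim_transform_eventually[OF s(2)[of x]] x by (simp add: f'_def)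
      qed
    qed
    show "x \<in> V"
      unfolding f(2) by (rule closed_sequentially[OF V(2) _ lim]) (simp add: t)
  qed
  then show ?thesis by auto
qed

section \<open>Uniqueness of the extensions\<close>

text \<open>The set where two bounded linear maps agree is a closed subspace.\<close>

lemma bounded_linear_eq_on_tests:
  fixes F G :: "hspace \<Rightarrow> hspace"
  assumes F: "bounded_linear F" and G: "bounded_linear G"
    and eq: "\<And>f. f \<in> test_functions \<Longrightarrow> F (to_H f) = G (to_H f)"
  shows "F = G"
proof -
  interpret F: bounded_linear F by (rule F)
  interpret G: bounded_linear G by (rule G)
  have "{x. F x = G x} = UNIV"
  proof (rule closed_subspace_of_tests_UNIV)
    show "subspace {x. F x = G x}"
      by (auto simp: subspace_def F.zero G.zero F.add G.add F.scaleR G.scaleR)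
    show "closed {x. F x = G x}"
      by (intro closed_Collect_eq F.continuous_on G.continuous_on continuous_on_id)
  qed (use eq in auto)
  then show ?thesis by auto
qed

lemma Gamma_extension_unique:
  assumes F: "Gamma_extension \<mu> F" and G: "Gamma_extension \<mu> G"
  shows "F = G"
proof -
  have bil: "bounded_bilinear F" "bounded_bilinear G"
    using F G by (auto simp: Gamma_extension_def)
  have tests: "F (to_H g) (to_H h) = G (to_H g) (to_H h)" if "g \<in> test_functions" "h \<in> test_functions" for g h
    using F G that by (simp add: Gamma_extension_def)
  have left: "F (to_H g) = G (to_H g)" if "g \<in> test_functions" for g
    using tests that bil
    by (intro bounded_linear_eq_on_tests bounded_bilinear.bounded_linear_right) auto
  have "(\<lambda>x. F x y) = (\<lambda>x. G x y)" for y
    using left bil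
    by (intro bounded_linear_eq_on_tests bounded_bilinear.bounded_linear_left) auto
  then show ?thesis by (metis ext)
qed

lemma bounded_trilinear_slots:
  assumes "bounded_trilinear T"
  shows "bounded_linear (\<lambda>x. T x y z)" "bounded_linear (\<lambda>y. T x y z)" "bounded_linear (\<lambda>z. T x y z)"
proof -
  obtain K where K: "\<And>x y z. norm (T x y z) \<le> K * norm x * norm y * norm z"
    and lin: "linear (\<lambda>x. T x y z)" "linear (\<lambda>y. T x y z)" "linear (\<lambda>z. T x y z)"
    using assms by (auto simp: bounded_trilinear_def)
  show "bounded_linear (\<lambda>x. T x y z)"
    using lin(1) K[of _ y z]
    by (intro bounded_linear.intro bounded_linear_axioms.intro exI[of _ "K * norm y * norm z"]) (simp_all add: mult_ac)
  show "bounded_linear (\<lambda>y. T x y z)"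
    using lin(2) K[of x _ z]
    by (intro bounded_linear.intro bounded_linear_axioms.intro exI[of _ "K * norm x * norm z"]) (simp_all add: mult_ac)
  show "bounded_linear (\<lambda>z. T x y z)"
    using lin(3) K[of x y]
    by (intro bounded_linear.intro bounded_linear_axioms.intro exI[of _ "K * norm x * norm y"]) (simp_all add: mult_ac)
qed

lemma Q_extension_unique:
  assumes F: "Q_extension \<mu> F" and G: "Q_extension \<mu> G"
  shows "F = G"
proof -
  have tri: "bounded_trilinear F" "bounded_trilinear G"
    using F G by (auto simp: Q_extension_def)
  have tests: "F (to_H g) (to_H h) (to_H l) = G (to_H g) (to_H h) (to_H l)"
    if "g \<in> test_functions" "h \<in> test_functions" "l \<in> test_functions" for g h l
    using F G that by (simp add: Q_extension_def)
  have third: "F (to_H g) (to_H h) = G (to_H g) (to_H h)" if "g \<in> test_functions" "h \<in> test_functions" for g h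
    using tests that tri by (intro bounded_linear_eq_on_tests bounded_trilinear_slots) auto
  have second: "(\<lambda>y. F (to_H g) y z) = (\<lambda>y. G (to_H g) y z)" if "g \<in> test_functions" for g z
    using third that tri by (intro bounded_linear_eq_on_tests bounded_trilinear_slots) auto
  have "(\<lambda>x. F x y z) = (\<lambda>x. G x y z)" for y z
    using fun_cong[OF second] tri by (intro bounded_linear_eq_on_tests bounded_trilinear_slots) auto
  then show ?thesis by (metis ext)
qed

theorem proposition3p1:
  fixes \<mu> :: real
  assumes "\<mu> > 0"
  shows "(\<forall>\<omega>>0. \<forall>g\<in>test_functions. \<forall>h\<in>test_functions. \<forall>l\<in>test_functions.
            set_integrable lborel (coll_domain \<omega>) (Gamma_integrand \<mu> g h \<omega>) \<and>
            set_integrable lborel (coll_domain \<omega>) (Q_integrand \<mu> g h l \<omega>)) \<and>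
         (\<exists>!G. Gamma_extension \<mu> G) \<and>
         (\<exists>!T. Q_extension \<mu> T) \<and>
         (\<exists>C>0. \<forall>g h l :: hspace.
            norm (Gamma_H \<mu> g h) \<le> C * norm g * norm h \<and>
            norm (Q_H \<mu> g h l) \<le> C * norm g * norm h * norm l)"
proof (intro conjI)
  show "\<forall>\<omega>>0. \<forall>g\<in>test_functions. \<forall>h\<in>test_functions. \<forall>l\<in>test_functions.
            set_integrable lborel (coll_domain \<omega>) (Gamma_integrand \<mu> g h \<omega>) \<and>
            set_integrable lborel (coll_domain \<omega>) (Q_integrand \<mu> g h l \<omega>)"
    using integrands_set_integrable[OF assms] by blast
  note ext = Gamma_map_extension[OF assms] Q_map_extension[OF assms]
  show unique: "\<exists>!G. Gamma_extension \<mu> G" "\<exists>!T. Q_extension \<mu> T"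
    using ext Gamma_extension_unique Q_extension_unique by blast+
  have eq: "Gamma_H \<mu> = Gamma_map \<mu>" "Q_H \<mu> = Q_map \<mu>"
    unfolding Gamma_H_def Q_H_def by (rule the1_equality, fact unique, fact ext)+
  (* The summand 1 makes the constant strictly positive. *)
  let ?C = "collision_bound \<mu> + 1"
  have "norm (Gamma_map \<mu> g h) \<le> ?C * norm g * norm h" for g h
    by (rule order_trans[OF norm_Gamma_map_le[OF assms]]) (intro mult_right_mono; simp)
  moreover have "norm (Q_map \<mu> g h l) \<le> ?C * norm g * norm h * norm l" for g h l
    by (rule order_trans[OF norm_Q_map_le[OF assms]]) (intro mult_right_mono; simp)
  moreover have "?C > 0"
    using collision_bound(1)[OF assms] by simp
  ultimately show "\<exists>C>0. \<forall>g h l :: hspace.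
            norm (Gamma_H \<mu> g h) \<le> C * norm g * norm h \<and>
            norm (Q_H \<mu> g h l) \<le> C * norm g * norm h * norm l"
    unfolding eq by blast
qed

end
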